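(* If $D$ is a locally in-semicomplete CKI-digraph or a locally out-semicomplete CKI-digraph, then $D$ is a directed odd cycle, $D\cong \overrightarrow{C}_7(1,2)$, or $D\cong \overrightarrow{C}_n(1,\pm2,\pm3,\dots,\pm\lfloor \frac{n}{2}\rfloor)$ for some $n\ge4$.
   Context: Digraphs are finite, without loops or parallel arcs; both arcs $uv$ and $vu$ may be present. A digraph is semicomplete if every two distinct vertices are joined by at least one arc. $D$ is locally in-semicomplete (resp. locally out-semicomplete) if for every vertex $v$ the in-neighbourhood $N^-(v)$ (resp. out-neighbourhood $N^+(v)$) induces a semicomplete subdigraph. A kernel is a set $S$ of vertices that is independent (no arc between two vertices of $S$) and absorbent (every vertex outside $S$ has an arc into $S$). $D$ is a CKI-digraph if $D$ has no kernel but every proper induced subdigraph has a kernel. For nonempty $J\subseteq\mathbb{Z}_m\setminus\{0\}$, $\overrightarrow{C}_m(J)$ has vertex set $\mathbb{Z}_m$ and arcs $(i,j)$ with $j-i\in J$; $\overrightarrow{C}_7(1,2)$ has $J=\{1,2\}$ and $\overrightarrow{C}_n(1,\pm2,\dots,\pm\lfloor n/2\rfloor)$ has $J=\{1\}\cup\{\pm k:2\le k\le\lfloor n/2\rfloor\}$. *)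

theory Defs
  imports "Graph_Theory.Graph_Theory" "HOL-Number_Theory.Cong"
begin

definition semicomplete :: "('a, 'b) pre_digraph \<Rightarrow> bool" where
  "semicomplete G \<longleftrightarrow>
     (\<forall>u \<in> verts G. \<forall>v \<in> verts G. u \<noteq> v \<longrightarrow> u \<rightarrow>\<^bsub>G\<^esub> v \<or> v \<rightarrow>\<^bsub>G\<^esub> u)"

definition in_neighbourhood :: "('a, 'b) pre_digraph \<Rightarrow> 'a \<Rightarrow> 'a set" where
  "in_neighbourhood G v = {u \<in> verts G. u \<rightarrow>\<^bsub>G\<^esub> v}"

definition out_neighbourhood :: "('a, 'b) pre_digraph \<Rightarrow> 'a \<Rightarrow> 'a set" where
  "out_neighbourhood G v = {u \<in> verts G. v \<rightarrow>\<^bsub>G\<^esub> u}"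

definition locally_in_semicomplete :: "('a, 'b) pre_digraph \<Rightarrow> bool" where
  "locally_in_semicomplete G \<longleftrightarrow>
     (\<forall>v \<in> verts G. semicomplete (G \<restriction> in_neighbourhood G v))"

definition locally_out_semicomplete :: "('a, 'b) pre_digraph \<Rightarrow> bool" where
  "locally_out_semicomplete G \<longleftrightarrow>
     (\<forall>v \<in> verts G. semicomplete (G \<restriction> out_neighbourhood G v))"

definition independent_in :: "('a, 'b) pre_digraph \<Rightarrow> 'a set \<Rightarrow> bool" where
  "independent_in G S \<longleftrightarrow> (\<forall>u \<in> S. \<forall>v \<in> S. \<not> u \<rightarrow>\<^bsub>G\<^esub> v)"

definition absorbent_in :: "('a, 'b) pre_digraph \<Rightarrow> 'a set \<Rightarrow> bool" where
  "absorbent_in G S \<longleftrightarrow> (\<forall>u \<in> verts G - S. \<exists>v \<in> S. u \<rightarrow>\<^bsub>G\<^esub> v)"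

definition is_kernel :: "('a, 'b) pre_digraph \<Rightarrow> 'a set \<Rightarrow> bool" where
  "is_kernel G S \<longleftrightarrow> S \<subseteq> verts G \<and> independent_in G S \<and> absorbent_in G S"

definition has_kernel :: "('a, 'b) pre_digraph \<Rightarrow> bool" where
  "has_kernel G \<longleftrightarrow> (\<exists>S. is_kernel G S)"

text \<open>
  The quantifier over proper induced subdigraphs includes the null digraph; this is harmless, since
  the empty set is a kernel of it.
\<close>
definition CKI_digraph :: "('a, 'b) pre_digraph \<Rightarrow> bool" where
  "CKI_digraph G \<longleftrightarrow> digraph G \<and> \<not> has_kernel G \<and>
     (\<forall>H. induced_subgraph H G \<and> verts H \<noteq> verts G \<longrightarrow> has_kernel H)"

text \<open>
  The digraph consists of exactly the vertices and arcs of one closed walk without repeated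
  vertices. A \<^const>\<open>pre_digraph.cycle\<close> may be a loop, but not in a loopfree digraph, so there the
  length is at least 3.
\<close>
definition directed_odd_cycle :: "('a, 'b) pre_digraph \<Rightarrow> bool" where
  "directed_odd_cycle G \<longleftrightarrow>
     (\<exists>p. pre_digraph.cycle G p \<and> odd (length p) \<and> arcs G = set p \<and> verts G = tail G ` set p)"

text \<open>
  The residues modulo \<open>m\<close> are represented by \<open>0, \<dots>, m - 1\<close>, and \<open>J\<close> is a set of
  arbitrary integer representatives of connection residues, so that negative elements may be used
  directly.
\<close>
definition circulant_digraph :: "nat \<Rightarrow> int set \<Rightarrow> (int, int \<times> int) pre_digraph" where
  "circulant_digraph m J = with_proj
     \<lparr> pverts = {0..<int m},
       parcs = {(i, j). i \<in> {0..<int m} \<and> j \<in> {0..<int m} \<and> (\<exists>k \<in> J. [j - i = k] (mod int m))} \<rparr>"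

end

theory Submission
  imports Defs "Jordan_Normal_Form.Determinant"
begin

text \<open>
  Suppose in-neighbourhoods are semicomplete. Deleting a vertex \<open>k\<close> leaves a kernel \<open>T\<close>, and exactly
  one \<open>s \<in> T\<close> has an arc to \<open>k\<close>. Exchanging \<open>s\<close> for \<open>k\<close> leaves an independent set whose
  unabsorbed vertices all lie in \<open>N\<^sup>-(s)\<close>, hence have a common sink, which is the next \<open>k\<close>. Iterating,
  tokens move along arcs forever; a shortest return of a token forces the tokens to move in strict
  rotation, so the entering vertices satisfy \<open>y i \<rightarrow> y (i + r)\<close> and \<open>y (i + r + 1) \<rightarrow> y i\<close>, while
  any \<open>r\<close> consecutive ones are independent. If \<open>r = 1\<close>, all \<open>y i\<close> are adjacent and the digraph is
  semicomplete, and then a shortest asymmetric cycle is spanning. If \<open>r \<ge> 2\<close>, either some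
  \<open>2 * r + 1\<close> consecutive \<open>y i\<close> induce a directed odd cycle, or \<open>y i \<rightarrow> y (i + 2 * r)\<close> throughout;
  the latter gives a shorter induced odd cycle when \<open>r \<ge> 3\<close> and the second circulant when \<open>r = 2\<close>.

  If instead out-neighbourhoods are semicomplete, a set \<open>S\<close> is a kernel iff it meets every closed
  out-neighbourhood in exactly one vertex. The kernels of the vertex-deleted subdigraphs thus give a
  0/1 factorisation of \<open>J - I\<close>, which forces the digraph to be regular. A sink of the clique
  \<open>N\<^sup>+[v]\<close> then has \<open>N\<^sup>+[v]\<close> as its closed in-neighbourhood, and in this way all in-neighbourhoods
  are seen to be semicomplete, unless the whole digraph is.
\<close>

section \<open>Exchange sequences\<close>

text \<open>Kernels of the subdigraph induced on \<open>X\<close>, expressed through the arc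
  relation alone, so that no subdigraph has to be formed.\<close>

definition kernel_on :: "('a \<Rightarrow> 'a \<Rightarrow> bool) \<Rightarrow> 'a set \<Rightarrow> 'a set \<Rightarrow> bool" where
  "kernel_on E X S \<longleftrightarrow>
     S \<subseteq> X \<and> (\<forall>u\<in>S. \<forall>v\<in>S. \<not> E u v) \<and> (\<forall>u\<in>X - S. \<exists>v\<in>S. E u v)"

lemma kernel_onI:
  assumes "S \<subseteq> X" "\<And>u v. u \<in> S \<Longrightarrow> v \<in> S \<Longrightarrow> \<not> E u v"
    and "\<And>u. u \<in> X \<Longrightarrow> u \<notin> S \<Longrightarrow> \<exists>v\<in>S. E u v"
  shows "kernel_on E X S"
  using assms by (auto simp: kernel_on_def)

locale CKI_relation =
  fixes V :: "'a set" and E :: "'a \<Rightarrow> 'a \<Rightarrow> bool"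
  assumes finite_V: "finite V"
    and E_in_V: "E u v \<Longrightarrow> u \<in> V \<and> v \<in> V"
    and irrefl: "\<not> E v v"
    and no_kernel: "\<not> kernel_on E V S"
    and proper_kernel: "X \<subset> V \<Longrightarrow> \<exists>S. kernel_on E X S"
begin

lemma V_nonempty: "V \<noteq> {}"
  using no_kernel[of "{}"] by (auto simp: kernel_on_def)

text \<open>The standard way to determine \<open>V\<close>: a kernel-free configuration found inside
  the digraph is already all of it.\<close>

lemma no_kernel_imp_eq:
  assumes "X \<subseteq> V" "\<And>S. \<not> kernel_on E X S"
  shows "X = V"
  using assms proper_kernel[of X] by blast

text \<open>Otherwise \<open>{v}\<close> would be a kernel. In a semicomplete digraph this yields an
  arc out of \<open>v\<close> whose reverse is missing.\<close>

lemma asym_out_arc: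
  assumes "v \<in> V"
  shows "\<exists>u\<in>V. u \<noteq> v \<and> \<not> E u v"
  using no_kernel[of "{v}"] assms irrefl by (auto simp: kernel_on_def)

definition uncovered :: "'a set \<Rightarrow> 'a set" where
  "uncovered T = {w \<in> V. w \<notin> T \<and> (\<forall>t\<in>T. \<not> E w t)}"

text \<open>Adding \<open>k\<close> to \<open>T\<close> makes every vertex absorbed, and
  \<open>uncovered\<close> excludes arcs from \<open>k\<close> to \<open>T\<close>. Hence only an
  arc from \<open>T\<close> to \<open>k\<close> can keep the enlarged set from being a
  kernel.\<close>

definition almost_kernel :: "'a set \<Rightarrow> 'a \<Rightarrow> bool" where
  "almost_kernel T k \<longleftrightarrow> T \<subseteq> V \<and> (\<forall>u\<in>T. \<forall>v\<in>T. \<not> E u v) \<and> k \<in> uncovered T \<and>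
     (\<forall>w\<in>uncovered T. w = k \<or> E w k)"

lemma almost_kernel_conflict:
  assumes "almost_kernel T k"
  shows "\<exists>s\<in>T. E s k"
proof (rule ccontr)
  assume "\<not> ?thesis"
  then have "kernel_on E V (insert k T)"
    using assms irrefl by (intro kernel_onI) (auto simp: almost_kernel_def uncovered_def)
  then show False using no_kernel by blast
qed

end

locale in_semicomplete_CKI = CKI_relation +
  assumes in_sc: "E u x \<Longrightarrow> E v x \<Longrightarrow> u = v \<or> E u v \<or> E v u"
begin

text \<open>A vertex uncovered after the exchange has an arc to \<open>s\<close>: otherwise it was
  uncovered before, hence equal to \<open>k\<close> or absorbed by \<open>k\<close>. So the
  uncovered vertices lie in the in-neighbourhood of \<open>s\<close>, and the kernel of the set they
  form is a single vertex, the next \<open>k\<close>.\<close>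

lemma almost_kernel_step:
  assumes good: "almost_kernel T k" and s: "s \<in> T" "E s k"
  shows "\<exists>k'. almost_kernel (insert k (T - {s})) k' \<and> E k' s"
proof -
  let ?T = "insert k (T - {s})"
  have T: "T \<subseteq> V" "\<And>u v. u \<in> T \<Longrightarrow> v \<in> T \<Longrightarrow> \<not> E u v" "k \<in> V" "k \<notin> T" "\<And>t. t \<in> T \<Longrightarrow> \<not> E k t"
    "\<And>w. w \<in> uncovered T \<Longrightarrow> w = k \<or> E w k"
    using good by (auto simp: almost_kernel_def uncovered_def)
  have only_s: "\<not> E t k" if "t \<in> T" "t \<noteq> s" for t
    using in_sc[of t k s] s that T(2) by blast
  have indep: "\<not> E u v" if "u \<in> ?T" "v \<in> ?T" for u v
    using that T only_s irrefl by auto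
  have W: "E w s" if "w \<in> uncovered ?T" for w
    using that T(6)[of w] s by (auto simp: uncovered_def)
  have "uncovered ?T \<subset> V"
    using T(3) by (auto simp: uncovered_def)
  then obtain K where K: "kernel_on E (uncovered ?T) K"
    using proper_kernel by blast
  have "uncovered ?T \<noteq> {}"
  proof
    assume "uncovered ?T = {}"
    then have "kernel_on E V ?T"
      using T indep by (intro kernel_onI) (auto simp: uncovered_def)
    then show False using no_kernel by blast
  qed
  then have "K \<noteq> {}" using K by (auto simp: kernel_on_def)
  then obtain k' where k': "k' \<in> K" by blast
  have "K = {k'}"
  proof -
    have "x = k'" if "x \<in> K" for x
      using that k' K W in_sc[of x s k'] unfolding kernel_on_def by blast
    then show ?thesis using k' by blast
  qed
  with K have "k' \<in> uncovered ?T" "\<And>w. w \<in> uncovered ?T \<Longrightarrow> w = k' \<or> E w k'"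
    by (auto simp: kernel_on_def)
  then have "almost_kernel ?T k' \<and> E k' s"
    using W T(1,3) indep unfolding almost_kernel_def by blast
  then show ?thesis by blast
qed

lemma exchange_sequence:
  obtains T :: "nat \<Rightarrow> 'a set" and s k :: "nat \<Rightarrow> 'a"
  where "\<And>i. almost_kernel (T i) (k i)" "\<And>i. s i \<in> T i" "\<And>i. E (s i) (k i)"
    "\<And>i. T (Suc i) = insert (k i) (T i - {s i})" "\<And>i. E (k (Suc i)) (s i)"
proof -
  obtain v where v: "v \<in> V" using V_nonempty by blast
  then obtain S where S: "kernel_on E (V - {v}) S" using proper_kernel[of "V - {v}"] by blast
  have "v \<in> uncovered S"
  proof (rule ccontr)
    assume "v \<notin> uncovered S"
    then have "kernel_on E V S"
      using S v by (intro kernel_onI) (auto simp: uncovered_def kernel_on_def)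
    then show False using no_kernel by blast
  qed
  then have good: "almost_kernel S v"
    using S v by (auto simp: almost_kernel_def kernel_on_def uncovered_def)
  \<comment> \<open>\<open>P\<close> is the invariant of a state (tokens, leaving vertex, entering
    vertex); \<open>Q\<close> relates successive states.\<close>
  define P where "P = (\<lambda>(T, s, k). almost_kernel T k \<and> s \<in> T \<and> E s k)"
  define Q where "Q = (\<lambda>(T, s, k) (T', s' :: 'a, k'). T' = insert k (T - {s}) \<and> E k' s)"
  obtain s where "s \<in> S" "E s v" using almost_kernel_conflict[OF good] by blast
  then have "P (S, s, v)" using good by (simp add: P_def)
  moreover have "\<exists>y. P y \<and> Q x y" if "P x" for x
  proof -
    obtain T s k where x: "x = (T, s, k)" by (cases x)
    then have "almost_kernel T k" "s \<in> T" "E s k" using \<open>P x\<close> by (auto simp: P_def)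
    then obtain k' where k': "almost_kernel (insert k (T - {s})) k'" "E k' s"
      using almost_kernel_step by blast
    obtain s' where "s' \<in> insert k (T - {s})" "E s' k'"
      using almost_kernel_conflict[OF k'(1)] by blast
    then have "P (insert k (T - {s}), s', k') \<and> Q x (insert k (T - {s}), s', k')"
      using k' x by (simp add: P_def Q_def)
    then show ?thesis by blast
  qed
  ultimately obtain f where f: "\<And>n. P (f n)" "\<And>n. Q (f n) (f (Suc n))"
    using dependent_nat_choice[of "\<lambda>_. P" "\<lambda>_. Q"] by blast
  show thesis
    by (rule that[of "\<lambda>i. fst (f i)" "\<lambda>i. snd (snd (f i))" "\<lambda>i. fst (snd (f i))"])
      (use f in \<open>simp_all add: P_def Q_def split_beta\<close>)
qed

text \<open>First in, first out: \<open>r\<close> is the least number of steps a vertex stays after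
  entering. Once this minimum is attained it is attained at every later step, and the indices are
  shifted to start there.\<close>

lemma rotation_sequence:
  obtains y :: "nat \<Rightarrow> 'a" and T :: "nat \<Rightarrow> 'a set" and r :: nat
  where "r > 0"
    "\<And>i. almost_kernel (T i) (y i)"
    "\<And>i. T (Suc (i + r)) = insert (y (i + r)) (T (i + r) - {y i})"
    "\<And>i. E (y i) (y (i + r))" "\<And>i. E (y (i + r + 1)) (y i)"
    "\<And>a b. a < b \<Longrightarrow> b \<le> a + r \<Longrightarrow> y a \<in> T b"
proof -
  obtain T s k where seq: "\<And>i. almost_kernel (T i) (k i)" "\<And>i. s i \<in> T i" "\<And>i. E (s i) (k i)"
    "\<And>i. T (Suc i) = insert (k i) (T i - {s i})" "\<And>i. E (k (Suc i)) (s i)"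
    by (rule exchange_sequence) blast
  have indep: "\<not> E u v" if "u \<in> T i" "v \<in> T i" for u v i
    using seq(1)[of i] that by (auto simp: almost_kernel_def)
  have unc: "k i \<notin> T i" "t \<in> T i \<Longrightarrow> \<not> E (k i) t" for i t
    using seq(1)[of i] by (auto simp: almost_kernel_def uncovered_def)
  have removed: "s i \<notin> T (Suc i)" for i
    using seq(3)[of i] irrefl by (auto simp: seq(4))
  have stays: "x \<in> T b" if "x \<in> T a" "a \<le> b" "\<And>l. a \<le> l \<Longrightarrow> l < b \<Longrightarrow> s l \<noteq> x" for x a b
    using that(2,3)
  proof (induction b rule: dec_induct)
    case base then show ?case using that(1) by simp
  next
    case (step n) then show ?case by (auto simp: seq(4))
  qed
  \<comment> \<open>A token present at time \<open>b\<close> that has not entered since time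
    \<open>a\<close> was already present at \<open>a\<close>.\<close>
  have traceback: "x \<in> T a" if "x \<in> T b" "a \<le> b" "\<And>l. a \<le> l \<Longrightarrow> l < b \<Longrightarrow> k l \<noteq> x" for x a b
    using that(2,3)
  proof (induction a rule: inc_induct)
    case base then show ?case using that(1) by simp
  next
    case (step n)
    then have "x \<in> T (Suc n)" "k n \<noteq> x" by auto
    then show ?case by (auto simp: seq(4))
  qed
  define gap where "gap r \<longleftrightarrow> r > 0 \<and> (\<exists>i. s (i + r) = k i)" for r
  \<comment> \<open>By finiteness some vertex leaves twice, so it entered again in between.\<close>
  have "\<exists>r. gap r"
  proof -
    have "range s \<subseteq> V" using seq(1,2) unfolding almost_kernel_def by blast
    then have "\<not> inj s" using finite_V finite_imageD finite_subset infinite_UNIV_nat by metis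
    then obtain a b where ab: "a < b" "s a = s b" by (metis injI linorder_neqE_nat)
    have "\<exists>l. Suc a \<le> l \<and> l < b \<and> k l = s b"
      using traceback[of "s b" b "Suc a"] removed[of a] seq(2)[of b] ab by fastforce
    then obtain l where "l < b" "k l = s b" by blast
    then have "gap (b - l)" unfolding gap_def by (auto intro!: exI[of _ l])
    then show ?thesis ..
  qed
  define r where "r = (LEAST r. gap r)"
  have "gap r" unfolding r_def using \<open>\<exists>r. gap r\<close> by (auto intro: LeastI)
  have least: "r \<le> j - i" if "i < j" "s j = k i" for i j
  proof -
    have "gap (j - i)" using that by (auto simp: gap_def intro!: exI[of _ i])
    then show ?thesis unfolding r_def by (rule Least_le)
  qed
  have r: "r > 0" using \<open>gap r\<close> by (simp add: gap_def)
  obtain i0 where i0: "s (i0 + r) = k i0" using \<open>gap r\<close> by (auto simp: gap_def)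
  \<comment> \<open>By minimality of \<open>r\<close>, no vertex leaves sooner than \<open>r\<close>
    steps after it enters.\<close>
  have keep: "k a \<in> T b" if "a < b" "b \<le> a + r" for a b
  proof (rule stays[of _ "Suc a"])
    show "k a \<in> T (Suc a)" by (simp add: seq(4))
    show "s l \<noteq> k a" if "Suc a \<le> l" "l < b" for l
      using least[of a l] that \<open>b \<le> a + r\<close> by auto
  qed (use that in auto)
  \<comment> \<open>Suppose another token \<open>c\<close> leaves instead. By minimality it did not
    enter after time \<open>i\<close>, so it was present at time \<open>i\<close> together with
    \<open>s i\<close>. Both \<open>y\<close> and \<open>s i\<close> have arcs to
    \<open>k i\<close>; since \<open>E (s i) y\<close> would make \<open>c\<close> and
    \<open>s i\<close> adjacent, \<open>E y (s i)\<close> holds. Now \<open>b\<close> and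
    \<open>y\<close> share the out-neighbour \<open>s i\<close>, which forces \<open>E b y\<close>;
    then the tokens \<open>b\<close> and \<open>c\<close> share the out-neighbour \<open>y\<close>,
    so they coincide.\<close>
  have step: "s (Suc i + r) = k (Suc i)" if i: "s (i + r) = k i" for i
  proof (rule ccontr)
    assume contra: "s (Suc i + r) \<noteq> k (Suc i)"
    define j where "j = i + r"
    define c where "c = s (Suc j)"
    define y where "y = k (Suc j)"
    have c: "c \<in> T (Suc j)" "E c y" using seq(2,3) by (auto simp: c_def y_def)
    have y: "E y (k i)" using seq(5)[of j] i by (simp add: y_def j_def)
    have nk: "k l \<noteq> c" if "i < l" "l \<le> j" for l
    proof
      assume "k l = c"
      then have "r \<le> Suc j - l" using least[of l "Suc j"] that by (auto simp: c_def)
      then have "l = Suc i" using that by (simp add: j_def)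
      then show False using \<open>k l = c\<close> contra by (simp add: c_def j_def)
    qed
    have cT: "c \<in> T l" if "i < l" "l \<le> Suc j" for l
      using traceback[OF c(1), of l] nk that by simp
    have "c \<noteq> k i" using removed[of j] c(1) i by (auto simp: j_def)
    then have cTi: "c \<in> T i" "c \<noteq> s i" using cT[of "Suc i"] by (auto simp: seq(4) j_def)
    have nadj: "\<not> E c (s i)" "\<not> E (s i) c" using indep cTi seq(2) by blast+
    have "y \<noteq> s i" using c nadj by blast
    then have "E y (s i) \<or> E (s i) y" using in_sc[OF y seq(3)] by blast
    then have ys: "E y (s i)" using in_sc[of "s i" y c] c nadj cTi by blast
    define b where "b = k (Suc i)"
    have "b \<in> T (Suc j)" unfolding b_def by (rule keep) (use r in \<open>auto simp: j_def\<close>)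
    then have "y \<noteq> b" "\<not> E y b" using unc(1)[of "Suc j"] unc(2)[of b "Suc j"] by (auto simp: y_def)
    moreover have "E b (s i)" using seq(5) by (simp add: b_def)
    ultimately have "E b y" using in_sc ys by blast
    then have "b = c" using in_sc[of b y c] c indep \<open>b \<in> T (Suc j)\<close> by blast
    then show False using contra by (simp add: b_def c_def j_def)
  qed
  have rot: "s (i0 + i + r) = k (i0 + i)" for i
    by (induction i) (use i0 step in auto)
  show thesis
  proof (rule that[of r "\<lambda>i. T (i0 + i)" "\<lambda>i. k (i0 + i)"])
    show "T (i0 + Suc (i + r)) = insert (k (i0 + (i + r))) (T (i0 + (i + r)) - {k (i0 + i)})" for i
      using rot[of i] seq(4)[of "i0 + i + r"] by (simp add: add.assoc)
    show "E (k (i0 + i)) (k (i0 + (i + r)))" for i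
      using seq(3)[of "i0 + i + r"] rot[of i] by (simp add: add.assoc)
    show "E (k (i0 + (i + r + 1))) (k (i0 + i))" for i
      using seq(5)[of "i0 + i + r"] rot[of i] by (simp add: add.assoc)
    show "k (i0 + a) \<in> T (i0 + b)" if "a < b" "b \<le> a + r" for a b
      using that by (intro keep) auto
  qed (use r seq(1) in auto)
qed

end

section \<open>Rotating tokens\<close>

text \<open>Membership in a kernel flips along the only out-arc of a vertex. Going once around an
  induced odd cycle therefore refutes a kernel.\<close>

lemma kernel_on_unique_out:
  assumes "kernel_on E X K" "u \<in> X" "w \<in> X" "E u w" "\<And>x. x \<in> X \<Longrightarrow> E u x \<Longrightarrow> x = w"
  shows "u \<in> K \<longleftrightarrow> w \<notin> K"
  using assms unfolding kernel_on_def by blast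

text \<open>Isomorphism with \<open>circulant_digraph n J\<close> at the level of relations; the
  bijection runs from residues to vertices.\<close>

definition circulant_on :: "'a set \<Rightarrow> ('a \<Rightarrow> 'a \<Rightarrow> bool) \<Rightarrow> nat \<Rightarrow> int set \<Rightarrow> bool" where
  "circulant_on V E n J \<longleftrightarrow> (\<exists>g. bij_betw g {0..<int n} V \<and>
     (\<forall>i\<in>{0..<int n}. \<forall>j\<in>{0..<int n}. E (g i) (g j) \<longleftrightarrow> (\<exists>k\<in>J. [j - i = k] (mod int n))))"

text \<open>Multiplication by a unit \<open>c\<close> permutes the residues and carries the
  connection set \<open>J\<close> to its multiple by \<open>c\<close>.\<close>

lemma circulant_on_multiplier:
  assumes "n > 0" and c: "coprime c (int n)" and h: "bij_betw h {0..<int n} V"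
    and arcs: "\<And>a b. a \<in> {0..<int n} \<Longrightarrow> b \<in> {0..<int n} \<Longrightarrow>
      E (h a) (h b) \<longleftrightarrow> (\<exists>k\<in>J. [b - a = c * k] (mod int n))"
  shows "circulant_on V E n J"
proof -
  define m where "m p = (c * p) mod int n" for p
  have m_in: "m p \<in> {0..<int n}" for p using \<open>n > 0\<close> by (simp add: m_def)
  have "inj_on m {0..<int n}"
  proof (rule inj_onI)
    fix p q assume pq: "p \<in> {0..<int n}" "q \<in> {0..<int n}" "m p = m q"
    then have "[c * p = c * q] (mod int n)" by (simp add: m_def cong_def)
    then have "[p = q] (mod int n)" using c cong_mult_lcancel by blast
    then show "p = q" using pq by (simp add: cong_def)
  qed
  then have "bij_betw m {0..<int n} {0..<int n}"
    using m_in by (intro bij_betw_imageI endo_inj_surj) auto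
  then have "bij_betw (h \<circ> m) {0..<int n} V" using h by (rule bij_betw_trans)
  moreover have "E ((h \<circ> m) i) ((h \<circ> m) j) \<longleftrightarrow> (\<exists>k\<in>J. [j - i = k] (mod int n))" for i j
  proof -
    have "[m j - m i = c * k] (mod int n) \<longleftrightarrow> [j - i = k] (mod int n)" for k
    proof -
      have "[m j - m i = c * (j - i)] (mod int n)"
        by (simp add: m_def cong_def mod_diff_eq right_diff_distrib)
      then have "[m j - m i = c * k] (mod int n) \<longleftrightarrow> [c * (j - i) = c * k] (mod int n)"
        using cong_sym cong_trans by blast
      then show ?thesis using cong_mult_lcancel[OF c] by simp
    qed
    then show ?thesis using arcs[OF m_in m_in] by simp
  qed
  ultimately show ?thesis unfolding circulant_on_def by (intro exI[of _ "h \<circ> m"]) auto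
qed

section \<open>Rotations of length at least two: adjacency within a window of the sequence\<close>

locale token_rotation = in_semicomplete_CKI +
  fixes y :: "nat \<Rightarrow> 'a" and r :: nat
  assumes two_le: "2 \<le> r"
    and forward: "b = a + r \<Longrightarrow> E (y a) (y b)"
    and not_forward_rev: "b = a + r \<Longrightarrow> \<not> E (y b) (y a)"
    and backward: "a = b + r + 1 \<Longrightarrow> E (y a) (y b)"
    and near: "a < b \<Longrightarrow> b < a + r \<Longrightarrow> y a \<noteq> y b \<and> \<not> E (y a) (y b) \<and> \<not> E (y b) (y a)"
begin

lemma y_in_V: "y a \<in> V"
  using forward[of "a + r" a] E_in_V by blast

text \<open>The reverse arc would give \<open>y b\<close> and \<open>y (b + 1)\<close> the common
  out-neighbour \<open>y a\<close>, but these two are not adjacent.\<close>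

lemma not_backward_rev: "a = b + r + 1 \<Longrightarrow> \<not> E (y b) (y a)"
  using in_sc[of "y b" "y a" "y (b + 1)"] forward[of a "b + 1"] near[of b "b + 1"] two_le by auto

text \<open>Either arc would create a common out-neighbour of two nearby entries: of
  \<open>y a\<close> and \<open>y (b - r)\<close>, or of \<open>y b\<close> and
  \<open>y (a + r + 1)\<close>.\<close>

lemma far:
  assumes "a + r + 2 \<le> b" "b < a + 2 * r"
  shows "y a \<noteq> y b \<and> \<not> E (y a) (y b) \<and> \<not> E (y b) (y a)"
proof -
  have f: "E (y (b - r)) (y b)" using assms by (intro forward) auto
  have g: "E (y (a + r + 1)) (y a)" by (rule backward) simp
  have n: "y a \<noteq> y (b - r) \<and> \<not> E (y a) (y (b - r)) \<and> \<not> E (y (b - r)) (y a)"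
    using assms by (intro near) auto
  have n': "y (a + r + 1) \<noteq> y b \<and> \<not> E (y (a + r + 1)) (y b) \<and> \<not> E (y b) (y (a + r + 1))"
    using assms by (intro near) auto
  show ?thesis using f g n n' in_sc by metis
qed

text \<open>The arc from \<open>y b\<close> to \<open>y a\<close> would make the nearby entries
  \<open>y b\<close> and \<open>y (a + r + 1)\<close> adjacent. The opposite arc is left open, and
  the classification branches on it.\<close>

lemma double:
  assumes "b = a + 2 * r"
  shows "y a \<noteq> y b \<and> \<not> E (y b) (y a)"
proof -
  have "E (y (a + r)) (y b)" using assms by (intro forward) auto
  moreover have "\<not> E (y (a + r)) (y a)" by (rule not_forward_rev) simp
  moreover have g: "E (y (a + r + 1)) (y a)" by (rule backward) simp
  moreover have n': "y (a + r + 1) \<noteq> y b \<and> \<not> E (y (a + r + 1)) (y b) \<and> \<not> E (y b) (y (a + r + 1))"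
    using assms two_le by (intro near) auto
  ultimately show ?thesis using in_sc by metis
qed

lemma window_distinct:
  assumes "a < b" "b \<le> a + 2 * r"
  shows "y a \<noteq> y b"
proof -
  consider "b < a + r" | "b = a + r" | "b = a + r + 1" | "a + r + 2 \<le> b" "b < a + 2 * r" | "b = a + 2 * r"
    using assms by linarith
  then show ?thesis
    using near[of a b] forward[of b a] backward[of b a] far[of a b] double[of b a] irrefl assms
    by cases metis+
qed

text \<open>Among \<open>2 * r + 1\<close> consecutive entries the earlier lemmas settle every pair
  except the arc from the first to the last, which the assumption excludes.\<close>

lemma window_arc_iff:
  assumes "\<not> E (y j) (y (j + 2 * r))" "a \<le> 2 * r" "b \<le> 2 * r"
  shows "E (y (j + a)) (y (j + b)) \<longleftrightarrow> b = a + r \<or> a = b + r + 1"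
proof -
  consider "a = b" | "a < b" "b < a + r" | "b = a + r" | "b = a + r + 1" | "a + r + 2 \<le> b" "b < a + 2 * r"
    | "a = 0" "b = 2 * r"
    | "b < a" "a < b + r" | "a = b + r" | "a = b + r + 1" | "b + r + 2 \<le> a" "a < b + 2 * r"
    | "b = 0" "a = 2 * r"
    using assms by linarith
  then show ?thesis
  proof cases
    case 1 then show ?thesis using irrefl two_le by auto
  next
    case 2 then show ?thesis using near[of "j + a" "j + b"] by auto
  next
    case 3 then show ?thesis using forward[of "j + b" "j + a"] by auto
  next
    case 4 then show ?thesis using not_backward_rev[of "j + b" "j + a"] by auto
  next
    case 5 then show ?thesis using far[of "j + a" "j + b"] by auto
  next
    case 6 then show ?thesis using assms two_le by auto
  next
    case 7 then show ?thesis using near[of "j + b" "j + a"] by auto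
  next
    case 8 then show ?thesis using not_forward_rev[of "j + a" "j + b"] two_le by auto
  next
    case 9 then show ?thesis using backward[of "j + a" "j + b"] by auto
  next
    case 10 then show ?thesis using far[of "j + b" "j + a"] by auto
  next
    case 11 then show ?thesis using double[of "j + a" "j + b"] two_le by auto
  qed
qed

text \<open>Modulo \<open>2 * r + 1\<close> both kinds of arc in the window add \<open>r\<close> to
  the index. Since \<open>r\<close> is a unit, the window is one induced odd cycle, which has no
  kernel and so fills \<open>V\<close>.\<close>

lemma odd_cycle_if_not_double:
  assumes j: "\<not> E (y j) (y (j + 2 * r))"
  shows "circulant_on V E (2 * r + 1) {1}"
proof -
  define X where "X = (\<lambda>a. y (j + a)) ` {..2 * r}"
  note arc = window_arc_iff[OF j]
  have "\<not> kernel_on E X K" for K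
  proof
    assume K: "kernel_on E X K"
    have succ: "y (j + a) \<in> K \<longleftrightarrow> y (j + b) \<notin> K"
      if "a \<le> 2 * r" "b \<le> 2 * r" "b = a + r \<or> a = b + r + 1" for a b
    proof (rule kernel_on_unique_out[OF K])
      show "E (y (j + a)) (y (j + b))" using arc that by blast
      show "x = y (j + b)" if "x \<in> X" "E (y (j + a)) x" for x
      proof -
        obtain c where c: "c \<le> 2 * r" "x = y (j + c)" using \<open>x \<in> X\<close> by (auto simp: X_def)
        then have "c = a + r \<or> a = c + r + 1" using arc[of a c] that \<open>a \<le> 2 * r\<close> by blast
        then have "c = b" using \<open>b = a + r \<or> a = b + r + 1\<close> \<open>c \<le> 2 * r\<close> \<open>b \<le> 2 * r\<close> by auto
        then show ?thesis using c by simp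
      qed
    qed (use that in \<open>auto simp: X_def\<close>)
    \<comment> \<open>Two arcs lead from index \<open>m + 1\<close> through \<open>m + 1 + r\<close>
      to \<open>m\<close>, so membership is constant on the indices up to \<open>r\<close>; the
      single arc from 0 to \<open>r\<close> contradicts this.\<close>
    have "m \<le> r \<Longrightarrow> y (j + m) \<in> K \<longleftrightarrow> y (j + 0) \<in> K" for m
    proof (induction m)
      case (Suc m)
      have "y (j + Suc m) \<in> K \<longleftrightarrow> y (j + (Suc m + r)) \<notin> K" using Suc.prems by (intro succ) auto
      moreover have "y (j + (Suc m + r)) \<in> K \<longleftrightarrow> y (j + m) \<notin> K"
        using Suc.prems by (intro succ) auto
      ultimately show ?case using Suc by simp
    qed simp
    moreover have "y (j + 0) \<in> K \<longleftrightarrow> y (j + r) \<notin> K" by (rule succ) auto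
    ultimately show False by blast
  qed
  then have XV: "X = V" by (intro no_kernel_imp_eq) (auto simp: X_def y_in_V)
  define h where "h p = y (j + nat p)" for p
  have inj: "inj_on h {0..<int (2 * r + 1)}"
  proof (rule linorder_inj_onI)
    show "h p \<noteq> h q" if "p < q" "p \<in> {0..<int (2 * r + 1)}" "q \<in> {0..<int (2 * r + 1)}" for p q
      using window_distinct[of "j + nat p" "j + nat q"] that by (auto simp: h_def)
  qed auto
  have "h ` {0..<int (2 * r + 1)} = X"
    unfolding X_def h_def
    by (force simp: image_iff intro: bexI[of _ "int _"])
  then have bij: "bij_betw h {0..<int (2 * r + 1)} V" using inj XV by (simp add: bij_betw_def)
  show ?thesis
  proof (rule circulant_on_multiplier[OF _ _ bij])
    have "coprime (int r) (2 * int r + 1)"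
      by (metis coprime_add_one_right coprime_mult_left_iff)
    then show "coprime (int r) (int (2 * r + 1))" by (simp add: ac_simps)
    fix a b assume ab: "a \<in> {0..<int (2 * r + 1)}" "b \<in> {0..<int (2 * r + 1)}"
    have "E (h a) (h b) \<longleftrightarrow> nat b = nat a + r \<or> nat a = nat b + r + 1"
      unfolding h_def using ab by (intro arc) auto
    also have "\<dots> \<longleftrightarrow> b - a - r = 0 \<or> b - a - r = - (2 * int r + 1)" using ab by auto
    \<comment> \<open>The difference \<open>b - a - r\<close> lies between \<open>-3 * r\<close> and
      \<open>r\<close>, so the quotient can only be 0 or -1.\<close>
    also have "\<dots> \<longleftrightarrow> (2 * int r + 1) dvd (b - a - r)"
    proof
      assume "(2 * int r + 1) dvd (b - a - r)"
      then obtain q where q: "b - a - r = (2 * int r + 1) * q" ..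
      have "q < 1"
      proof (rule ccontr)
        assume "\<not> q < 1"
        then have "(2 * int r + 1) * 1 \<le> (2 * int r + 1) * q" by (intro mult_left_mono) auto
        then have "2 * int r + 1 \<le> b - a - r" using q by simp
        then show False using ab by auto
      qed
      moreover have "q > -2"
      proof (rule ccontr)
        assume "\<not> q > -2"
        then have "(2 * int r + 1) * q \<le> (2 * int r + 1) * (-2)" by (intro mult_left_mono) auto
        then have "b - a - r \<le> (2 * int r + 1) * (-2)" using q by simp
        then show False using ab by auto
      qed
      ultimately have "q = 0 \<or> q = -1" by linarith
      then show "b - a - r = 0 \<or> b - a - r = - (2 * int r + 1)" using q by auto
    qed (auto simp: dvd_def intro: exI[of _ "-1"])
    finally show "E (h a) (h b) \<longleftrightarrow> (\<exists>k\<in>{1}. [b - a = int r * k] (mod int (2 * r + 1)))"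
      by (simp add: cong_iff_dvd_diff ac_simps)
  qed simp
qed

end

section \<open>The case in which every entry also has an arc to the entry \<open>2 * r\<close>
  later\<close>

locale token_rotation_double = token_rotation +
  assumes double_forward: "b = a + 2 * r \<Longrightarrow> E (y a) (y b)"
begin

text \<open>The two vertices share the out-neighbour \<open>y (b + r)\<close>. An arc from
  \<open>y b\<close> to \<open>y a\<close> is impossible, as \<open>y (b + 1)\<close> also has an
  arc to \<open>y a\<close>.\<close>

lemma double_backward:
  assumes "a = b + 2 * r + 1"
  shows "E (y a) (y b) \<and> \<not> E (y b) (y a)"
proof -
  have e: "E (y b) (y (b + r))" "E (y a) (y (b + r))" "E (y (b + 1)) (y a)"
    using forward[of "b + r" b] backward[of a "b + r"] double_forward[of a "b + 1"] assms by simp_all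
  have n: "y b \<noteq> y (b + 1) \<and> \<not> E (y b) (y (b + 1)) \<and> \<not> E (y (b + 1)) (y b)"
    using two_le by (intro near) auto
  have "y a \<noteq> y b" using e n by metis
  moreover have "\<not> E (y b) (y a)" using e n in_sc by metis
  ultimately show ?thesis using e in_sc by metis
qed

text \<open>The argument of \<open>far\<close> with \<open>2 * r\<close> in place of
  \<open>r\<close>.\<close>

lemma very_far:
  assumes "a + 2 * r + 2 \<le> b" "b < a + 3 * r"
  shows "\<not> E (y a) (y b) \<and> \<not> E (y b) (y a)"
proof -
  have f: "E (y (b - 2 * r)) (y b)" using assms by (intro double_forward) auto
  have g: "E (y (a + 2 * r + 1)) (y a)" using double_backward by blast
  have n: "y a \<noteq> y (b - 2 * r) \<and> \<not> E (y a) (y (b - 2 * r)) \<and> \<not> E (y (b - 2 * r)) (y a)"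
    using assms by (intro near) auto
  have n': "y (a + 2 * r + 1) \<noteq> y b \<and> \<not> E (y (a + 2 * r + 1)) (y b) \<and> \<not> E (y b) (y (a + 2 * r + 1))"
    using assms by (intro near) auto
  show ?thesis using f g n n' in_sc by metis
qed

lemma double_arc_shift:
  assumes "d < 3 * r"
  shows "E (y a) (y (a + d)) \<longleftrightarrow> d = r \<or> d = 2 * r"
    and "E (y (a + d)) (y a) \<longleftrightarrow> d = r + 1 \<or> d = 2 * r + 1"
proof -
  consider "d = 0" | "0 < d" "d < r" | "d = r" | "d = r + 1" | "r + 2 \<le> d" "d < 2 * r"
    | "d = 2 * r" | "d = 2 * r + 1" | "2 * r + 2 \<le> d"
    by linarith
  then have "(E (y a) (y (a + d)) \<longleftrightarrow> d = r \<or> d = 2 * r) \<and>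
    (E (y (a + d)) (y a) \<longleftrightarrow> d = r + 1 \<or> d = 2 * r + 1)"
  proof cases
    case 1 then show ?thesis using irrefl two_le by auto
  next
    case 2 then show ?thesis using near[of a "a + d"] by auto
  next
    case 3 then show ?thesis
      using forward[of "a + d" a] not_forward_rev[of "a + d" a] two_le by auto
  next
    case 4 then show ?thesis
      using backward[of "a + d" a] not_backward_rev[of "a + d" a] two_le by auto
  next
    case 5 then show ?thesis using far[of a "a + d"] by auto
  next
    case 6 then show ?thesis
      using double_forward[of "a + d" a] double[of "a + d" a] two_le by auto
  next
    case 7 then show ?thesis using double_backward[of "a + d" a] two_le by auto
  next
    case 8 then show ?thesis using very_far[of a "a + d"] assms by auto
  qed
  then show "E (y a) (y (a + d)) \<longleftrightarrow> d = r \<or> d = 2 * r"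
    and "E (y (a + d)) (y a) \<longleftrightarrow> d = r + 1 \<or> d = 2 * r + 1" by blast+
qed

lemma double_arc_iff:
  assumes "a < b + 3 * r" "b < a + 3 * r"
  shows "E (y a) (y b) \<longleftrightarrow> b = a + r \<or> b = a + 2 * r \<or> a = b + r + 1 \<or> a = b + 2 * r + 1"
proof (cases "a \<le> b")
  case True
  then show ?thesis using double_arc_shift(1)[of "b - a" a] assms by auto
next
  case False
  then show ?thesis using double_arc_shift(2)[of "a - b" b] assms by auto
qed

text \<open>For \<open>r\<close> at least 3 there is an induced odd cycle avoiding a vertex of the
  sequence, although a kernel-free induced subdigraph must be everything.\<close>

lemma r_eq_2: "r = 2"
proof (rule ccontr)
  assume "r \<noteq> 2"
  then have "3 \<le> r" using two_le by simp
  then obtain m where m: "r = m + 3" by (metis add.commute le_Suc_ex)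
  \<comment> \<open>The vertices with these indices induce a directed cycle of length \<open>2 * r - 1\<close>.\<close>
  define I where "I = {a. a \<le> m \<or> a = m + 2 \<or> a = 2 * m + 4 \<or>
    (2 * m + 6 \<le> a \<and> a \<le> 3 * m + 6) \<or> a = 3 * m + 8}"
  define X where "X = y ` I"
  have small: "a < 3 * r" if "a \<in> I" for a using that by (auto simp: I_def m)
  have arc: "E (y a) (y b) \<longleftrightarrow> b = a + r \<or> b = a + 2 * r \<or> a = b + r + 1 \<or> a = b + 2 * r + 1"
    if "a \<in> I" "b \<in> I" for a b
    using small[OF that(1)] small[OF that(2)] by (intro double_arc_iff) auto
  \<comment> \<open>\<open>f a\<close> is the index of the only out-neighbour within
    \<open>I\<close>. The cycle alternates between low indices \<open>a\<close> and
    \<open>a + 2 * r\<close>, descending from \<open>m\<close> to 0, and returns from 0 to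
    \<open>m\<close> through \<open>2 * r\<close>, \<open>m + 2\<close>, \<open>3 * m + 8\<close>,
    \<open>2 * m + 4\<close>.\<close>
  define f where "f a = (if a \<le> m then a + 2 * r else if a = m + 2 then 3 * m + 8
    else if a = 2 * m + 4 then m else if a = 2 * m + 6 then m + 2
    else if a = 3 * m + 8 then 2 * m + 4 else a - 2 * r - 1)" for a
  have out: "b = f a"
    if "a \<in> I" "b \<in> I" and b: "b = a + r \<or> b = a + 2 * r \<or> a = b + r + 1 \<or> a = b + 2 * r + 1"
    for a b
  proof -
    have "a \<le> m \<or> a = m + 2 \<or> a = 2 * m + 4 \<or> a = 2 * m + 6
        \<or> 2 * m + 7 \<le> a \<and> a \<le> 3 * m + 6 \<or> a = 3 * m + 8"
      using \<open>a \<in> I\<close> by (auto simp: I_def)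
    then consider "a \<le> m" | "a = m + 2" | "a = 2 * m + 4" | "a = 2 * m + 6"
      | "2 * m + 7 \<le> a" "a \<le> 3 * m + 6" | "a = 3 * m + 8"
      by blast
    then show ?thesis
      using b \<open>b \<in> I\<close> by cases (auto simp: I_def f_def m)
  qed
  have "\<not> kernel_on E X K" for K
  proof
    assume K: "kernel_on E X K"
    have succ: "y a \<in> K \<longleftrightarrow> y b \<notin> K"
      if "a \<in> I" "b \<in> I" "b = a + r \<or> b = a + 2 * r \<or> a = b + r + 1 \<or> a = b + 2 * r + 1" for a b
    proof (rule kernel_on_unique_out[OF K])
      show "E (y a) (y b)" using arc that by blast
      show "x = y b" if "x \<in> X" "E (y a) x" for x
      proof -
        obtain c where c: "c \<in> I" "x = y c" using \<open>x \<in> X\<close> by (auto simp: X_def)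
        then have "c = a + r \<or> c = a + 2 * r \<or> a = c + r + 1 \<or> a = c + 2 * r + 1"
          using arc[of a c] that \<open>a \<in> I\<close> by blast
        then have "c = b"
          using out[of a b] out[of a c] \<open>a \<in> I\<close> \<open>b \<in> I\<close> \<open>c \<in> I\<close>
            \<open>b = a + r \<or> b = a + 2 * r \<or> a = b + r + 1 \<or> a = b + 2 * r + 1\<close>
          by blast
        then show ?thesis using c by simp
      qed
    qed (use that in \<open>auto simp: X_def\<close>)
    have low: "a \<le> m \<Longrightarrow> y a \<in> K \<longleftrightarrow> y 0 \<in> K" for a
    proof (induction a)
      case (Suc a)
      have "y (Suc a) \<in> K \<longleftrightarrow> y (Suc a + 2 * r) \<notin> K"
        using Suc.prems by (intro succ) (auto simp: I_def m)
      moreover have "y (Suc a + 2 * r) \<in> K \<longleftrightarrow> y a \<notin> K"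
        using Suc.prems by (intro succ) (auto simp: I_def m)
      ultimately show ?case using Suc by simp
    qed simp
    \<comment> \<open>Five flips lead from 0 to \<open>m\<close>, whereas \<open>low\<close> gives
      both the same membership.\<close>
    have "y 0 \<in> K \<longleftrightarrow> y (2 * r) \<notin> K" by (intro succ) (auto simp: I_def m)
    moreover have "y (2 * r) \<in> K \<longleftrightarrow> y (m + 2) \<notin> K" by (intro succ) (auto simp: I_def m)
    moreover have "y (m + 2) \<in> K \<longleftrightarrow> y (3 * m + 8) \<notin> K" by (intro succ) (auto simp: I_def m)
    moreover have "y (3 * m + 8) \<in> K \<longleftrightarrow> y (2 * m + 4) \<notin> K" by (intro succ) (auto simp: I_def m)
    moreover have "y (2 * m + 4) \<in> K \<longleftrightarrow> y m \<notin> K" by (intro succ) (auto simp: I_def m)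
    ultimately show False using low[of m] by blast
  qed
  \<comment> \<open>The vertex \<open>y (m + 1)\<close> is missing from \<open>X\<close>: all
    indices in \<open>I\<close> lie within \<open>2 * r\<close> of \<open>m + 1\<close>, except
    \<open>3 * m + 8\<close>, which is \<open>2 * r + 1\<close> away and is separated by an
    arc.\<close>
  then have "X = V" by (intro no_kernel_imp_eq) (auto simp: X_def y_in_V)
  then obtain a where a: "a \<in> I" "y (m + 1) = y a" using y_in_V[of "m + 1"] by (auto simp: X_def)
  have "a \<noteq> m + 1" using a by (auto simp: I_def)
  moreover have "a \<noteq> 3 * m + 8"
    using double_backward[of "3 * m + 8" "m + 1"] a irrefl by (auto simp: m)
  ultimately have "a < m + 1 \<or> m + 1 < a" "a \<le> m + 1 + 2 * r"
    using a(1) by (auto simp: I_def m)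
  then show False
    using window_distinct[of a "m + 1"] window_distinct[of "m + 1" a] a(2)
    by (auto simp: m)
qed

text \<open>Entries 0 to 6 carry the arcs of index difference 2 and 4 modulo 7, which is the
  circulant on \<open>{1, 2}\<close> up to the multiplier 2.\<close>

lemma seven_cycle: "circulant_on V E 7 {1, 2}"
proof -
  have arc: "E (y a) (y b) \<longleftrightarrow> b = a + 2 \<or> b = a + 4 \<or> a = b + 3 \<or> a = b + 5"
    if "a < b + 6" "b < a + 6" for a b
    using double_arc_iff[of a b] that by (auto simp: r_eq_2)
  have not_6_0: "\<not> E (y 6) (y 0)"
    using in_sc[of "y 6" "y 0" "y 5"] arc[of 5 0] near[of 5 6] by (auto simp: r_eq_2)
  \<comment> \<open>Such an arc closes the directed triangle through 0, 6 and 3; being kernel-free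
    it would be all of \<open>V\<close>, yet \<open>y 1\<close> lies outside it.\<close>
  have not_0_6: "\<not> E (y 0) (y 6)"
  proof
    assume e: "E (y 0) (y 6)"
    have "\<not> kernel_on E {y 0, y 6, y 3} K" for K
    proof
      assume K: "kernel_on E {y 0, y 6, y 3} K"
      have "y 0 \<in> K \<longleftrightarrow> y 6 \<notin> K"
        by (rule kernel_on_unique_out[OF K]) (use e irrefl arc[of 0 3] in auto)
      moreover have "y 6 \<in> K \<longleftrightarrow> y 3 \<notin> K"
        by (rule kernel_on_unique_out[OF K]) (use not_6_0 irrefl arc[of 6 3] in auto)
      moreover have "y 3 \<in> K \<longleftrightarrow> y 0 \<notin> K"
        by (rule kernel_on_unique_out[OF K]) (use irrefl arc[of 3 0] arc[of 3 6] in auto)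
      ultimately show False by blast
    qed
    then have "{y 0, y 6, y 3} = V" by (intro no_kernel_imp_eq) (auto simp: y_in_V)
    then have "y 1 \<in> {y 0, y 6, y 3}" using y_in_V by simp
    then show False
      using window_distinct[of 0 1] window_distinct[of 1 3] double_backward[of 6 1] irrefl[of "y 1"]
      by (auto simp: r_eq_2)
  qed
  define h where "h p = y (nat p)" for p
  define X where "X = h ` {0..<7}"
  have X: "X = {y 0, y 1, y 2, y 3, y 4, y 5, y 6}"
  proof -
    have "{0..<7::int} = {0, 1, 2, 3, 4, 5, 6}" by auto
    then show ?thesis by (auto simp: X_def h_def)
  qed
  have arc': "E (h a) (h b) \<longleftrightarrow> (\<exists>k\<in>{1, 2}. [b - a = 2 * k] (mod 7))"
    if "a \<in> {0..<7}" "b \<in> {0..<7}" for a b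
  proof -
    have "E (h a) (h b) \<longleftrightarrow> b = a + 2 \<or> b = a + 4 \<or> a = b + 3 \<or> a = b + 5"
    proof (cases "a < b + 6 \<and> b < a + 6")
      case True
      then have "nat a < nat b + 6" "nat b < nat a + 6" using that by auto
      then have "E (h a) (h b) \<longleftrightarrow> nat b = nat a + 2 \<or> nat b = nat a + 4 \<or>
          nat a = nat b + 3 \<or> nat a = nat b + 5"
        unfolding h_def by (rule arc)
      also have "\<dots> \<longleftrightarrow> b = a + 2 \<or> b = a + 4 \<or> a = b + 3 \<or> a = b + 5" using that by auto
      finally show ?thesis .
    next
      case False
      then have "a = 0 \<and> b = 6 \<or> a = 6 \<and> b = 0" using that by auto
      then show ?thesis using not_6_0 not_0_6 by (auto simp: h_def)
    qed
    also have "\<dots> \<longleftrightarrow> 7 dvd (b - a - 2) \<or> 7 dvd (b - a - 4)"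
      using that by (auto; presburger)
    finally show ?thesis by (simp add: cong_iff_dvd_diff)
  qed
  have "\<not> kernel_on E X K" for K
  proof
    assume K: "kernel_on E X K"
    have ind: "y a \<notin> K \<or> y b \<notin> K" if "b = a + 2 \<or> b = a + 4 \<or> a = b + 3 \<or> a = b + 5" for a b
      using K arc[of a b] that by (auto simp: kernel_on_def)
    have abs: "\<exists>b\<le>6. y b \<in> K \<and> (b = a + 2 \<or> b = a + 4 \<or> a = b + 3 \<or> a = b + 5)"
      if "a \<le> 6" "y a \<notin> K" for a
    proof -
      have "y a \<in> X" using that(1) unfolding X_def h_def
        by (intro image_eqI[of _ _ "int a"]) auto
      then obtain x where x: "x \<in> K" "E (y a) x" "x \<in> X"
        using K \<open>y a \<notin> K\<close> unfolding kernel_on_def by blast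
      then obtain p where p: "p \<in> {0..<7}" "x = y (nat p)" by (auto simp: X_def h_def)
      define b where "b = nat p"
      have "b = a + 2 \<or> b = a + 4 \<or> a = b + 3 \<or> a = b + 5"
      proof (cases "a < b + 6 \<and> b < a + 6")
        case True
        then show ?thesis using arc[of a b] x p by (auto simp: b_def)
      next
        case False
        then have "a = 0 \<and> b = 6 \<or> a = 6 \<and> b = 0" using p that by (auto simp: b_def)
        then show ?thesis using x p not_6_0 not_0_6 by (auto simp: b_def)
      qed
      then show ?thesis using x p by (intro exI[of _ b]) (auto simp: b_def)
    qed
    have a0: "y 0 \<in> K \<or> y 2 \<in> K \<or> y 4 \<in> K" using abs[of 0] by (auto simp: numeral_eq_Suc)
    have a1: "y 1 \<in> K \<or> y 3 \<in> K \<or> y 5 \<in> K" using abs[of 1] by (auto simp: numeral_eq_Suc)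
    have a2: "y 2 \<in> K \<or> y 4 \<in> K \<or> y 6 \<in> K" using abs[of 2] by (auto simp: numeral_eq_Suc)
    have a3: "y 3 \<in> K \<or> y 5 \<in> K \<or> y 0 \<in> K" using abs[of 3] by (auto simp: numeral_eq_Suc)
    have a4: "y 4 \<in> K \<or> y 6 \<in> K \<or> y 1 \<in> K" using abs[of 4] by (auto simp: numeral_eq_Suc)
    have a5: "y 5 \<in> K \<or> y 2 \<in> K \<or> y 0 \<in> K" using abs[of 5] by (auto simp: numeral_eq_Suc)
    have a6: "y 6 \<in> K \<or> y 3 \<in> K \<or> y 1 \<in> K" using abs[of 6] by (auto simp: numeral_eq_Suc)
    have indep: "y 0 \<notin> K \<or> y 2 \<notin> K" "y 0 \<notin> K \<or> y 4 \<notin> K" "y 1 \<notin> K \<or> y 3 \<notin> K" "y 1 \<notin> K \<or> y 5 \<notin> K"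
      "y 2 \<notin> K \<or> y 4 \<notin> K" "y 2 \<notin> K \<or> y 6 \<notin> K" "y 3 \<notin> K \<or> y 5 \<notin> K" "y 3 \<notin> K \<or> y 0 \<notin> K"
      "y 4 \<notin> K \<or> y 6 \<notin> K" "y 4 \<notin> K \<or> y 1 \<notin> K" "y 5 \<notin> K \<or> y 2 \<notin> K" "y 5 \<notin> K \<or> y 0 \<notin> K"
      "y 6 \<notin> K \<or> y 3 \<notin> K" "y 6 \<notin> K \<or> y 1 \<notin> K"
      by (rule ind; simp)+
    \<comment> \<open>Behind this propositional step is a count: an independent set has at most two
      vertices, each absorbing two, so at most six of the seven are reached.\<close>
    show False
      using a0 a1 a2 a3 a4 a5 a6 indep by argo
  qed
  then have XV: "X = V" by (intro no_kernel_imp_eq) (auto simp: X_def h_def y_in_V)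
  \<comment> \<open>\<open>window_distinct\<close> reaches index difference 4; differences 5 and 6
    are separated by arcs.\<close>
  have "h p \<noteq> h q" if "p < q" "p \<in> {0..<7}" "q \<in> {0..<7}" for p q
  proof (cases "q = p + 5 \<or> q = p + 6")
    case True
    moreover have "y 0 \<noteq> y 6"
      using double_forward[of 4 0] not_forward_rev[of 6 4] forward[of 6 4] double[of 4 0]
      by (auto simp: r_eq_2)
    moreover have "y 0 \<noteq> y 5" "y 1 \<noteq> y 6"
      using double_backward[of 5 0] double_backward[of 6 1] irrefl by (auto simp: r_eq_2)
    moreover have "p = 0 \<and> q = 5 \<or> p = 1 \<and> q = 6 \<or> p = 0 \<and> q = 6" using True that by auto
    ultimately show ?thesis by (auto simp: h_def)
  next
    case False
    then have "nat p < nat q" "nat q \<le> nat p + 2 * r" using that by (auto simp: r_eq_2)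
    then show ?thesis unfolding h_def by (rule window_distinct)
  qed
  then have "inj_on h {0..<7}" by (intro linorder_inj_onI) auto
  then have "bij_betw h {0..<int 7} V" using XV by (simp add: bij_betw_def X_def)
  then show ?thesis by (rule circulant_on_multiplier[where c = 2, rotated 2]) (use arc' in auto)
qed

end

section \<open>Classification of the case of semicomplete in-neighbourhoods\<close>

context in_semicomplete_CKI
begin

lemma non_semicomplete_classification:
  assumes "u \<in> V" "v \<in> V" "u \<noteq> v" "\<not> E u v" "\<not> E v u"
  shows "(\<exists>n. odd n \<and> circulant_on V E n {1}) \<or> circulant_on V E 7 {1, 2}"
proof -
  obtain y T r where r: "r > 0" and T: "\<And>i. almost_kernel (T i) (y i)"
    and exch: "\<And>i. T (Suc (i + r)) = insert (y (i + r)) (T (i + r) - {y i})"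
    and fwd: "\<And>i. E (y i) (y (i + r))" and bwd: "\<And>i. E (y (i + r + 1)) (y i)"
    and inT: "\<And>a b. a < b \<Longrightarrow> b \<le> a + r \<Longrightarrow> y a \<in> T b"
    by (rule rotation_sequence) blast
  have indep: "\<not> E u v" if "u \<in> T i" "v \<in> T i" for u v i
    using T[of i] that by (auto simp: almost_kernel_def)
  have unc: "y i \<notin> T i" "t \<in> T i \<Longrightarrow> \<not> E (y i) t" for i t
    using T[of i] by (auto simp: almost_kernel_def uncovered_def)
  have yV: "y i \<in> V" for i using fwd E_in_V by blast
  show ?thesis
  proof (cases "r = 1")
    case True
    have T_Suc: "T (Suc (Suc i)) = insert (y (Suc i)) (T (Suc i) - {y i})" for i
      using exch[of i] True by simp
    \<comment> \<open>The tokens that never move when only one token travels.\<close>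
    define R where "R = T 1 - {y 0}"
    have TR: "T (Suc i) = insert (y i) R" "y i \<notin> R" for i
    proof -
      have "T (Suc i) = insert (y i) R \<and> y i \<notin> R"
      proof (induction i)
        case 0 then show ?case using inT[of 0 1] True by (auto simp: R_def)
      next
        case (Suc i) then show ?case using T_Suc[of i] unc(1)[of "Suc i"] by auto
      qed
      then show "T (Suc i) = insert (y i) R" "y i \<notin> R" by auto
    qed
    \<comment> \<open>No \<open>y l\<close> has an arc into \<open>R\<close>. So either
      \<open>T (Suc i)\<close> absorbs or contains \<open>y l\<close> by means of
      \<open>y i\<close>, or \<open>y l\<close> is uncovered there and is, or has an arc to,
      \<open>y (Suc i)\<close>, an out-neighbour of \<open>y i\<close>.\<close>
    have adj: "y l = y i \<or> E (y l) (y i) \<or> E (y i) (y l)" for l i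
    proof -
      have 1: "\<not> E (y l) t" if "t \<in> R" for t
        using indep[of "y l" "Suc l" t] TR(1)[of l] that by auto
      show ?thesis
      proof (cases "y l \<in> uncovered (T (Suc i))")
        case True
        then have "y l = y (Suc i) \<or> E (y l) (y (Suc i))"
          using T[of "Suc i"] by (auto simp: almost_kernel_def)
        then show ?thesis using fwd[of i] \<open>r = 1\<close> in_sc[of "y l" "y (Suc i)" "y i"] by auto
      next
        case False
        then show ?thesis using 1 TR yV by (auto simp: uncovered_def)
      qed
    qed
    \<comment> \<open>A kernel of this semicomplete set is a single \<open>y i\<close>, which does
      not absorb \<open>y (Suc i)\<close>.\<close>
    have "\<not> kernel_on E (range y) K" for K
    proof
      assume K: "kernel_on E (range y) K"
      then have "K \<noteq> {}" "K \<subseteq> range y" by (auto simp: kernel_on_def)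
      then obtain i where i: "y i \<in> K" by blast
      have "E (y i) (y (Suc i))" using fwd[of i] True by simp
      moreover have "\<not> E (y (Suc i)) (y i)"
        using unc(2)[of "y i" "Suc i"] inT[of i "Suc i"] r by auto
      moreover have "x = y i" if "x \<in> K" for x
        using K i adj that unfolding kernel_on_def by (metis imageE subsetD)
      ultimately show False using K irrefl unfolding kernel_on_def by (metis DiffI rangeI)
    qed
    then have "range y = V" by (intro no_kernel_imp_eq) (auto simp: yV)
    then show ?thesis using assms adj by (metis rangeE)
  next
    case False
    then interpret token_rotation V E y r
    proof unfold_locales
      show "2 \<le> r" using r False by simp
      show near: "y a \<noteq> y b \<and> \<not> E (y a) (y b) \<and> \<not> E (y b) (y a)" if "a < b" "b < a + r" for a b
      proof -
        have "y a \<in> T b" "y a \<in> T (Suc b)" "y b \<in> T (Suc b)"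
          using that r by (auto intro: inT)
        then show ?thesis using unc(1)[of b] indep by metis
      qed
      show "\<not> E (y b) (y a)" if "b = a + r" for a b
        using inT[of a b] unc(2)[of "y a" b] that r by auto
    qed (use fwd bwd in auto)
    show ?thesis
    proof (cases "\<forall>j. E (y j) (y (j + 2 * r))")
      case True
      then interpret token_rotation_double V E y r by unfold_locales auto
      show ?thesis using seven_cycle by blast
    next
      case False
      then obtain j where "\<not> E (y j) (y (j + 2 * r))" by blast
      then have "circulant_on V E (2 * r + 1) {1}" by (rule odd_cycle_if_not_double)
      moreover have "odd (2 * r + 1)" by simp
      ultimately show ?thesis by blast
    qed
  qed
qed

end

section \<open>Semicomplete digraphs\<close>

context CKI_relation
begin

text \<open>A shortest closed walk of asymmetric arcs spans \<open>V\<close>, and its arcs are the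
  only asymmetric ones. Hence exactly the reversals of its arcs are missing.\<close>

lemma semicomplete_classification:
  assumes sc: "\<And>u v. u \<in> V \<Longrightarrow> v \<in> V \<Longrightarrow> u \<noteq> v \<Longrightarrow> E u v \<or> E v u"
  shows "\<exists>n\<ge>3. \<exists>g. bij_betw g {0..<int n} V \<and>
    (\<forall>i\<in>{0..<int n}. \<forall>j\<in>{0..<int n}.
      E (g i) (g j) \<longleftrightarrow> \<not> [j - i = 0] (mod int n) \<and> \<not> [j - i = - 1] (mod int n))"
proof -
  define R where "R = {(u, v). E u v \<and> \<not> E v u}"
  have out: "\<exists>u. (v, u) \<in> R" if "v \<in> V" for v
    using asym_out_arc[OF that] sc[OF that] that by (auto simp: R_def)
  have R_V: "(u, v) \<in> R \<Longrightarrow> u \<in> V \<and> v \<in> V" for u v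
    using E_in_V by (auto simp: R_def)
  define closed where "closed n \<longleftrightarrow> n > 0 \<and> (\<exists>v. (v, v) \<in> R ^^ n)" for n
  have "\<exists>n. closed n"
  proof -
    obtain v0 where v0: "v0 \<in> V" using V_nonempty by blast
    have "\<exists>f. f 0 = v0 \<and> (\<forall>n. f n \<in> V \<and> (f n, f (Suc n)) \<in> R)"
      using dependent_nat_choice[of "\<lambda>n v. v \<in> V \<and> (n = 0 \<longrightarrow> v = v0)" "\<lambda>_ u v. (u, v) \<in> R"]
        out R_V v0 by (metis Zero_not_Suc)
    then obtain f where f: "\<And>n. f n \<in> V" "\<And>n. (f n, f (Suc n)) \<in> R" by blast
    have "\<not> inj f"
      using f(1) finite_V by (metis finite_imageD finite_subset image_subsetI infinite_UNIV_nat)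
    then obtain a b where ab: "a < b" "f a = f b" by (metis injI linorder_neqE_nat)
    have "(f a, f (a + d)) \<in> R ^^ d" for d
      using f(2) by (induction d) auto
    from this[of "b - a"] have "(f a, f a) \<in> R ^^ (b - a)" using ab by simp
    then show ?thesis unfolding closed_def using ab by (intro exI[of _ "b - a"]) auto
  qed
  then have "closed (LEAST n. closed n)" by (rule LeastI_ex)
  moreover define n where "n = (LEAST n. closed n)"
  ultimately have "closed n" by simp
  have least: "n \<le> m" if "closed m" for m unfolding n_def using that by (rule Least_le)
  have n0: "n > 0" using \<open>closed n\<close> by (simp add: closed_def)
  obtain f where f: "f 0 = f n" "\<And>i. i < n \<Longrightarrow> (f i, f (Suc i)) \<in> R"
    using \<open>closed n\<close> unfolding closed_def relpow_fun_conv by metis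
  \<comment> \<open>The shortest closed walk, extended periodically to integer indices.\<close>
  define G where "G i = f (nat (i mod int n))" for i :: int
  have G_cong: "G i = G j" if "[i = j] (mod int n)" for i j
    using that by (simp add: G_def cong_def)
  have G_step: "(G i, G (i + 1)) \<in> R" for i
  proof -
    define a where "a = nat (i mod int n)"
    have a: "a < n" "[i = int a] (mod int n)"
      using n0 by (simp_all add: a_def nat_less_iff cong_def)
    have "G (i + 1) = G (int (Suc a))"
      using a(2) by (intro G_cong) (auto intro: cong_add simp: algebra_simps)
    also have "\<dots> = f (Suc a)"
    proof (cases "Suc a = n")
      case True
      then show ?thesis using f(1) by (simp add: G_def)
    next
      case False
      then show ?thesis using a(1) by (simp add: G_def nat_mod_distrib flip: of_nat_Suc)
    qed
    finally show ?thesis using f(2)[OF a(1)] by (simp add: G_def a_def)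
  qed
  have G_walk: "(G i, G (i + int d)) \<in> R ^^ d" for i d
  proof (induction d)
    case (Suc d)
    have "(G (i + int d), G (i + int d + 1)) \<in> R" by (rule G_step)
    with Suc have "(G i, G (i + int d + 1)) \<in> R ^^ Suc d" by (rule relpow_Suc_I)
    then show ?case by (simp add: ac_simps del: relpow.simps)
  qed simp
  have G_V: "G i \<in> V" for i using G_step R_V by blast
  have G_inj: "[i = j] (mod int n)" if "G i = G j" for i j
  proof (rule ccontr)
    assume ne: "\<not> [i = j] (mod int n)"
    define d where "d = nat ((j - i) mod int n)"
    have d: "d < n" "int d = (j - i) mod int n" using n0 by (simp_all add: d_def nat_less_iff)
    have "d > 0"
    proof (rule ccontr)
      assume "\<not> d > 0"
      then have "int n dvd j - i" using d by auto
      then show False using ne dvd_minus_iff[of "int n" "j - i"] by (simp add: cong_iff_dvd_diff)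
    qed
    have "G (i + int d) = G j"
      by (rule G_cong) (simp add: d cong_def mod_add_right_eq)
    then have "(G i, G i) \<in> R ^^ d" using G_walk[of i d] that by simp
    then have "closed d" using \<open>d > 0\<close> by (auto simp: closed_def)
    then show False using least d by fastforce
  qed
  \<comment> \<open>Following the walk from \<open>G j\<close> to \<open>G i\<close> and then the
    chord gives a closed walk of length \<open>d + 1\<close>, so minimality forces
    \<open>d + 1 = n\<close>.\<close>
  have chord: "[j = i + 1] (mod int n)" if "(G i, G j) \<in> R" for i j
  proof -
    define d where "d = nat ((i - j) mod int n)"
    have d: "d < n" "int d = (i - j) mod int n" using n0 by (simp_all add: d_def nat_less_iff)
    have "G (j + int d) = G i"
      by (rule G_cong) (simp add: d cong_def mod_add_right_eq)
    then have "(G j, G j) \<in> R ^^ Suc d" using G_walk[of j d] that by auto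
    then have "closed (Suc d)" by (auto simp: closed_def)
    then have "Suc d = n" using least d by fastforce
    then have "(i - j) mod int n = int n - 1" using d(2) by simp
    then have "i - j = (i - j) div int n * int n + (int n - 1)"
      using div_mult_mod_eq[of "i - j" "int n"] by simp
    then have "j - (i + 1) = int n * (- ((i - j) div int n) - 1)" by (simp add: algebra_simps)
    then have "int n dvd j - (i + 1)" by (rule dvdI)
    then show ?thesis by (simp add: cong_iff_dvd_diff)
  qed
  define X where "X = range G"
  \<comment> \<open>A kernel would be a single \<open>G i\<close>, but the arc from
    \<open>G i\<close> to \<open>G (i + 1)\<close> has no reverse.\<close>
  have "\<not> kernel_on E X K" for K
  proof
    assume K: "kernel_on E X K"
    then have "K \<noteq> {}" "K \<subseteq> X" by (auto simp: kernel_on_def X_def)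
    then obtain i where i: "G i \<in> K" by (auto simp: X_def)
    have "x = G i" if "x \<in> K" for x
      using K i that sc G_V \<open>K \<subseteq> X\<close> unfolding kernel_on_def X_def by (metis imageE subsetD)
    then show False
      using K G_step[of i] irrefl unfolding kernel_on_def X_def R_def
      by (metis (mono_tags, lifting) DiffI case_prodD mem_Collect_eq rangeI)
  qed
  then have XV: "X = V" by (intro no_kernel_imp_eq) (auto simp: X_def G_V)
  have arc: "E (G i) (G j) \<longleftrightarrow> \<not> [j - i = 0] (mod int n) \<and> \<not> [j - i = - 1] (mod int n)" for i j
  proof -
    have 1: "[j - i = 0] (mod int n) \<longleftrightarrow> G i = G j"
      using G_inj[of i j] G_cong[of i j] dvd_minus_iff[of "int n" "j - i"]
      by (auto simp: cong_iff_dvd_diff)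
    have 2: "[j - i = - 1] (mod int n) \<longleftrightarrow> [i = j + 1] (mod int n)"
      using dvd_minus_iff[of "int n" "j - i + 1"] by (simp add: cong_iff_dvd_diff algebra_simps)
    have 3: "[i = j + 1] (mod int n) \<longleftrightarrow> (G j, G i) \<in> R"
      using chord[of j i] G_step[of j] G_cong[of i "j + 1"] by auto
    show ?thesis unfolding 1 2 3 using sc[OF G_V G_V, of i j] irrefl by (auto simp: R_def)
  qed
  have "inj_on G {0..<int n}"
    by (rule inj_onI) (use G_inj in \<open>force simp: cong_def\<close>)
  moreover have "G ` {0..<int n} = V"
  proof -
    have "G i \<in> G ` {0..<int n}" for i
      using G_cong[of i "i mod int n"] n0 by (auto intro!: image_eqI[of _ _ "i mod int n"])
    then show ?thesis using XV by (auto simp: X_def)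
  qed
  ultimately have bij: "bij_betw G {0..<int n} V" by (simp add: bij_betw_def)
  have "n \<noteq> 1"
    using G_step[of 0] G_cong[of 0 1] irrefl by (auto simp: R_def)
  moreover have "n \<noteq> 2"
    using G_step[of 0] G_step[of 1] G_cong[of 0 2] by (auto simp: R_def cong_def)
  ultimately have "n \<ge> 3" using n0 by linarith
  then show ?thesis using bij arc by blast
qed

end

section \<open>Naming the semicomplete circulants\<close>

lemma circulant_3:
  assumes "bij_betw g {0..<int n} V" "n = 3"
    "\<forall>i\<in>{0..<int n}. \<forall>j\<in>{0..<int n}.
      E (g i) (g j) \<longleftrightarrow> \<not> [j - i = 0] (mod int n) \<and> \<not> [j - i = - 1] (mod int n)"
  shows "circulant_on V E 3 {1}"
proof -
  have "\<not> [d = 0] (mod 3) \<and> \<not> [d = - 1] (mod 3) \<longleftrightarrow> [d = 1] (mod 3)" for d :: int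
  proof -
    have "d mod 3 = 0 \<or> d mod 3 = 1 \<or> d mod 3 = 2" by presburger
    then show ?thesis by (auto simp: cong_def)
  qed
  then show ?thesis using assms unfolding circulant_on_def by (intro exI[of _ g]) auto
qed

lemma circulant_semicomplete:
  assumes "bij_betw g {0..<int n} V" "n \<ge> 4"
    "\<forall>i\<in>{0..<int n}. \<forall>j\<in>{0..<int n}.
      E (g i) (g j) \<longleftrightarrow> \<not> [j - i = 0] (mod int n) \<and> \<not> [j - i = - 1] (mod int n)"
  shows "circulant_on V E n ({1} \<union> (\<Union>k\<in>{2..\<lfloor>real n / 2\<rfloor>}. {k, - k}))"
proof -
  define J where "J = {1} \<union> (\<Union>k\<in>{2..\<lfloor>real n / 2\<rfloor>}. {k, - k})"
  have fl: "\<lfloor>real n / 2\<rfloor> = int n div 2"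
    using floor_divide_of_nat_eq[of n 2, where 'a = real] by (simp add: zdiv_int)
  have "\<not> [d = 0] (mod int n) \<and> \<not> [d = - 1] (mod int n) \<longleftrightarrow> (\<exists>k\<in>J. [d = k] (mod int n))" for d
  proof
    assume d: "\<not> [d = 0] (mod int n) \<and> \<not> [d = - 1] (mod int n)"
    define e where "e = d mod int n"
    have e: "[d = e] (mod int n)" "0 \<le> e" "e < int n" using \<open>n \<ge> 4\<close> by (auto simp: e_def cong_def)
    have "e \<noteq> 0" using d e by auto
    moreover have "e \<noteq> int n - 1"
    proof
      assume "e = int n - 1"
      then have "[d = int n - 1] (mod int n)" using e by simp
      moreover have "[int n - 1 = - 1] (mod int n)" by (simp add: cong_iff_dvd_diff)
      ultimately show False using d cong_trans by blast
    qed
    \<comment> \<open>Residues up to half of \<open>n\<close> represent themselves; the larger ones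
      are written as \<open>- (n - e)\<close>.\<close>
    ultimately consider "e = 1" | "2 \<le> e" "e \<le> int n div 2" | "2 \<le> int n - e" "int n - e \<le> int n div 2"
      using e by linarith
    then show "\<exists>k\<in>J. [d = k] (mod int n)"
    proof cases
      case 1
      then show ?thesis using e(1) by (intro bexI[of _ 1]) (auto simp: J_def)
    next
      case 2
      then show ?thesis using e(1) by (intro bexI[of _ e]) (auto simp: J_def fl)
    next
      case 3
      have "[e = - (int n - e)] (mod int n)" by (simp add: cong_iff_dvd_diff)
      then have "[d = - (int n - e)] (mod int n)" using e(1) cong_trans by blast
      moreover have "- (int n - e) \<in> J"
        unfolding J_def fl using 3 by (intro UnI2 UN_I[of "int n - e"]) auto
      ultimately show ?thesis by blast
    qed
  next
    assume "\<exists>k\<in>J. [d = k] (mod int n)"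
    then obtain k where k: "k \<in> J" "[d = k] (mod int n)" by blast
    have "k = 1 \<or> 2 \<le> \<bar>k\<bar> \<and> \<bar>k\<bar> \<le> int n div 2" using k(1) by (auto simp: J_def fl)
    then have b: "k \<noteq> 0" "k \<noteq> - 1" "k < int n" "- (int n) < k" "k + 1 < int n" "- (int n) < k + 1"
      using \<open>n \<ge> 4\<close> by auto
    have small: "m = 0" if "int n dvd m" "\<bar>m\<bar> < int n" for m
      using that zdvd_not_zless[of "\<bar>m\<bar>" "int n"] by auto
    have "\<bar>k\<bar> < int n" "\<bar>k + 1\<bar> < int n" using b by linarith+
    then have "\<not> [k = 0] (mod int n)" using small[of k] b by (auto simp: cong_iff_dvd_diff)
    moreover have "\<not> [k = - 1] (mod int n)"
      using small[of "k + 1"] b \<open>\<bar>k + 1\<bar> < int n\<close> by (auto simp: cong_iff_dvd_diff)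
    ultimately show "\<not> [d = 0] (mod int n) \<and> \<not> [d = - 1] (mod int n)"
      using k(2) cong_trans cong_sym by blast
  qed
  then show ?thesis using assms unfolding circulant_on_def J_def[symmetric] by (intro exI[of _ g]) auto
qed

lemma (in CKI_relation) semicomplete_CKI_circulant:
  assumes "\<And>u v. u \<in> V \<Longrightarrow> v \<in> V \<Longrightarrow> u \<noteq> v \<Longrightarrow> E u v \<or> E v u"
  shows "(\<exists>n. odd n \<and> circulant_on V E n {1}) \<or>
    (\<exists>n\<ge>4. circulant_on V E n ({1} \<union> (\<Union>k\<in>{2..\<lfloor>real n / 2\<rfloor>}. {k, - k})))"
proof -
  obtain n g where n: "n \<ge> 3" and g: "bij_betw g {0..<int n} V"
    "\<forall>i\<in>{0..<int n}. \<forall>j\<in>{0..<int n}.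
      E (g i) (g j) \<longleftrightarrow> \<not> [j - i = 0] (mod int n) \<and> \<not> [j - i = - 1] (mod int n)"
    using semicomplete_classification[OF assms] by blast
  show ?thesis
  proof (cases "n = 3")
    case True
    then have "circulant_on V E 3 {1}" using circulant_3[OF g(1) _ g(2)] by simp
    then show ?thesis by (intro disjI1 exI[of _ 3]) simp
  next
    case False
    then have "n \<ge> 4" using n by simp
    then show ?thesis using circulant_semicomplete[OF g(1) _ g(2)] by blast
  qed
qed

section \<open>Semicomplete out-neighbourhoods\<close>

lemma left_inverse_if_right_inverse:
  fixes X Z :: "'a \<Rightarrow> 'a \<Rightarrow> real"
  assumes "finite V"
    and XZ: "\<And>u v. u \<in> V \<Longrightarrow> v \<in> V \<Longrightarrow> (\<Sum>w\<in>V. X u w * Z w v) = of_bool (u = v)"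
    and "u \<in> V" "v \<in> V"
  shows "(\<Sum>w\<in>V. Z u w * X w v) = of_bool (u = v)"
proof -
  define n where "n = card V"
  obtain h where h: "bij_betw h {0..<n} V"
    using ex_bij_betw_nat_finite[OF \<open>finite V\<close>] by (auto simp: n_def)
  have hV: "h i \<in> V" if "i < n" for i using h that by (auto simp: bij_betw_def)
  have h_eq: "h i = h j \<longleftrightarrow> i = j" if "i < n" "j < n" for i j
    using h that by (auto simp: bij_betw_def inj_on_def)
  define A where "A = mat n n (\<lambda>(i, j). X (h i) (h j))"
  define B where "B = mat n n (\<lambda>(i, j). Z (h i) (h j))"
  have carr: "A \<in> carrier_mat n n" "B \<in> carrier_mat n n" by (auto simp: A_def B_def)
  have reindex: "(\<Sum>k\<in>{0..<n}. f (h k)) = (\<Sum>w\<in>V. f w)" for f :: "'a \<Rightarrow> real"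
    by (rule sum.reindex_bij_betw[OF h])
  have "A * B = 1\<^sub>m n"
  proof (rule eq_matI)
    fix i j assume "i < dim_row (1\<^sub>m n :: real mat)" "j < dim_col (1\<^sub>m n :: real mat)"
    then have ij: "i < n" "j < n" by auto
    then have "(A * B) $$ (i, j) = (\<Sum>k\<in>{0..<n}. X (h i) (h k) * Z (h k) (h j))"
      by (simp add: A_def B_def scalar_prod_def)
    also have "\<dots> = of_bool (h i = h j)"
      using reindex[of "\<lambda>w. X (h i) w * Z w (h j)"] XZ hV ij by simp
    finally show "(A * B) $$ (i, j) = 1\<^sub>m n $$ (i, j)" using ij h_eq by simp
  qed (use carr in auto)
  then have BA: "B * A = 1\<^sub>m n" by (rule mat_mult_left_right_inverse[OF carr])
  obtain i j where ij: "i < n" "j < n" "u = h i" "v = h j"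
    using h \<open>u \<in> V\<close> \<open>v \<in> V\<close> by (auto simp: bij_betw_def)
  have "(\<Sum>w\<in>V. Z u w * X w v) = (\<Sum>k\<in>{0..<n}. Z (h i) (h k) * X (h k) (h j))"
    using reindex[of "\<lambda>w. Z u w * X w v"] ij by simp
  also have "\<dots> = (B * A) $$ (i, j)" using ij by (simp add: A_def B_def scalar_prod_def)
  also have "\<dots> = of_bool (u = v)" using BA ij h_eq by simp
  finally show ?thesis .
qed

text \<open>With incidence matrices \<open>X\<close> of \<open>N\<close> and \<open>Y\<close> of
  \<open>S\<close>, the hypothesis \<open>meet\<close> says XY = J - I. Inverting \<open>X\<close>
  expresses YX through the row sums \<open>y\<close> of \<open>Y\<close> and the column sums
  \<open>c\<close> of \<open>X\<close>; integrality of YX then makes \<open>c\<close>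
  constant.\<close>

lemma regular_if_complementary:
  fixes N S :: "'a \<Rightarrow> 'a set"
  assumes fin: "finite V" and two: "card V \<ge> 2"
    and sub: "\<And>w. w \<in> V \<Longrightarrow> N w \<subseteq> V" "\<And>w. w \<in> V \<Longrightarrow> S w \<subseteq> V"
    and self: "\<And>w. w \<in> V \<Longrightarrow> w \<in> N w"
    and meet: "\<And>w v. w \<in> V \<Longrightarrow> v \<in> V \<Longrightarrow> card (N w \<inter> S v) = of_bool (w \<noteq> v)"
  shows "\<exists>c. \<forall>v\<in>V. card (N v) = c \<and> card {w \<in> V. v \<in> N w} = c"
proof -
  define m where "m = real (card V) - 1"
  have m: "m > 0" using two by (simp add: m_def)
  define X :: "'a \<Rightarrow> 'a \<Rightarrow> real" where "X u w = of_bool (w \<in> N u)" for u w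
  define Y :: "'a \<Rightarrow> 'a \<Rightarrow> real" where "Y w v = of_bool (w \<in> S v)" for w v
  define y where "y w = (\<Sum>v\<in>V. Y w v)" for w
  define c where "c v = (\<Sum>w\<in>V. X w v)" for v
  \<comment> \<open>The inverse of \<open>X\<close>: the vector \<open>y\<close> is mapped to the
    constant \<open>m\<close>, so the first term contributes J and the second subtracts J -
    I.\<close>
  define Z where "Z w v = y w / m - Y w v" for w v
  define YX where "YX u v = (\<Sum>w\<in>V. Y u w * X w v)" for u v
  have XY: "(\<Sum>w\<in>V. X u w * Y w v) = 1 - of_bool (u = v)" if "u \<in> V" "v \<in> V" for u v
  proof -
    have "(\<Sum>w\<in>V. X u w * Y w v) = (\<Sum>w\<in>V. of_bool (w \<in> N u \<inter> S v))"
      by (intro sum.cong) (auto simp: X_def Y_def)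
    also have "\<dots> = real (card (V \<inter> (N u \<inter> S v)))"
      using fin by (simp add: of_bool_def sum.If_cases Int_def)
    also have "V \<inter> (N u \<inter> S v) = N u \<inter> S v" using sub that by blast
    finally show ?thesis using meet[OF that] by simp
  qed
  have Xy: "(\<Sum>w\<in>V. X u w * y w) = m" if "u \<in> V" for u
  proof -
    have "(\<Sum>w\<in>V. X u w * y w) = (\<Sum>w\<in>V. \<Sum>v\<in>V. X u w * Y w v)"
      by (simp add: y_def sum_distrib_left)
    also have "\<dots> = (\<Sum>v\<in>V. \<Sum>w\<in>V. X u w * Y w v)" by (rule sum.swap)
    also have "\<dots> = (\<Sum>v\<in>V. 1 - of_bool (u = v))" using XY that by simp
    also have "\<dots> = m" using fin that by (simp add: sum_subtractf of_bool_def m_def)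
    finally show ?thesis .
  qed
  have "(\<Sum>w\<in>V. X u w * Z w v) = of_bool (u = v)" if "u \<in> V" "v \<in> V" for u v
  proof -
    have "(\<Sum>w\<in>V. X u w * Z w v) = (\<Sum>w\<in>V. X u w * y w) / m - (\<Sum>w\<in>V. X u w * Y w v)"
      by (simp add: Z_def right_diff_distrib sum_subtractf sum_divide_distrib)
    then show ?thesis using XY Xy that m by simp
  qed
  from left_inverse_if_right_inverse[OF fin this]
  have ZX: "(\<Sum>w\<in>V. Z u w * X w v) = of_bool (u = v)" if "u \<in> V" "v \<in> V" for u v
    using that by blast
  have YX: "YX u v = y u * c v / m - of_bool (u = v)" if "u \<in> V" "v \<in> V" for u v
  proof -
    have "(\<Sum>w\<in>V. Z u w * X w v) = y u / m * c v - YX u v"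
      by (simp add: Z_def YX_def c_def left_diff_distrib sum_subtractf sum_distrib_left)
    then show ?thesis using ZX[OF that] by simp
  qed
  have YX_nonneg: "YX u v \<ge> 0" for u v
    unfolding YX_def by (intro sum_nonneg) (simp add: X_def Y_def)
  \<comment> \<open>YX has the same trace as XY, namely 0, and nonnegative entries, so its diagonal
    vanishes.\<close>
  have "(\<Sum>u\<in>V. YX u u) = (\<Sum>w\<in>V. \<Sum>u\<in>V. X w u * Y u w)"
    unfolding YX_def by (subst sum.swap) (simp add: mult.commute)
  also have "\<dots> = 0" using XY by simp
  finally have "YX u u = 0" if "u \<in> V" for u
    using that fin YX_nonneg sum_nonneg_eq_0_iff by metis
  then have yc: "y u * c u = m" if "u \<in> V" for u
    using YX[OF that that] that m by (simp add: field_simps)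
  have c_card: "c v = real (card {w \<in> V. v \<in> N w})" for v
    using fin by (simp add: c_def X_def of_bool_def sum.If_cases Int_def)
  have c_pos: "c v > 0" if "v \<in> V" for v
    using self[OF that] that fin by (auto simp: c_card card_gt_0_iff)
  \<comment> \<open>Off the diagonal the entry of YX is \<open>c v / c u\<close>, a positive integer
    and hence at least 1.\<close>
  have c_le: "c u \<le> c v" if "u \<in> V" "v \<in> V" "u \<noteq> v" for u v
  proof -
    have "YX u v = y u * c v / m" using YX that by simp
    also have "\<dots> = c v / c u" using yc[OF that(1)] c_pos[OF that(1)] m by (simp add: field_simps)
    finally have eq: "YX u v = c v / c u" .
    have "YX u v = (\<Sum>w\<in>V. of_bool (u \<in> S w \<and> v \<in> N w))"
      unfolding YX_def by (intro sum.cong) (auto simp: X_def Y_def)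
    also have "\<dots> = real (card {w \<in> V. u \<in> S w \<and> v \<in> N w})"
      using fin by (simp add: of_bool_def sum.If_cases Int_def)
    finally obtain k :: nat where k: "YX u v = real k" by blast
    have "YX u v > 0" using eq c_pos that by simp
    then have "1 \<le> YX u v" using k by simp
    then show ?thesis using eq c_pos[OF that(1)] by simp
  qed
  obtain v0 where v0: "v0 \<in> V" using two by fastforce
  have c_eq: "c v = c v0" if "v \<in> V" for v
    using c_le[OF that v0] c_le[OF v0 that] by (cases "v = v0") auto
  have y_eq: "y w = m / c v0" if "w \<in> V" for w
    using yc[OF that] c_eq[OF that] c_pos[OF v0] by (simp add: field_simps)
  have row: "card (N u) = card {w \<in> V. v0 \<in> N w}" if "u \<in> V" for u
  proof -
    have "(\<Sum>w\<in>V. X u w * y w) = (\<Sum>w\<in>V. X u w * (m / c v0))"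
      using y_eq by simp
    then have "m = (\<Sum>w\<in>V. X u w) * (m / c v0)"
      unfolding sum_distrib_right using Xy[OF that] by simp
    then have "(\<Sum>w\<in>V. X u w) = c v0" using m c_pos[OF v0] by (simp add: field_simps)
    moreover have "(\<Sum>w\<in>V. X u w) = real (card (V \<inter> N u))"
      using fin by (simp add: X_def of_bool_def sum.If_cases Int_def)
    moreover have "V \<inter> N u = N u" using sub that by blast
    ultimately show ?thesis by (simp add: c_card)
  qed
  have "card {w \<in> V. v \<in> N w} = card {w \<in> V. v0 \<in> N w}" if "v \<in> V" for v
    using c_eq[OF that] by (simp add: c_card)
  then show ?thesis using row by blast
qed

locale out_semicomplete_CKI = CKI_relation +
  assumes out_sc: "E x u \<Longrightarrow> E x v \<Longrightarrow> u = v \<or> E u v \<or> E v u"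
begin

text \<open>Regularity makes each clique \<open>N v\<close> the closed in-neighbourhood of some
  \<open>q v\<close>. The map \<open>q\<close> permutes \<open>V\<close>, so every closed
  in-neighbourhood is a clique. The nonadjacent pair ensures that \<open>N v\<close> is a proper
  subset of \<open>V\<close>.\<close>

lemma in_semicomplete:
  assumes nadj: "u0 \<in> V" "v0 \<in> V" "u0 \<noteq> v0" "\<not> E u0 v0" "\<not> E v0 u0"
    and ux: "E u x" and vx: "E v x"
  shows "u = v \<or> E u v \<or> E v u"
proof -
  define N where "N v = insert v {u \<in> V. E v u}" for v
  have N_clique: "a = b \<or> E a b \<or> E b a" if "a \<in> N v" "b \<in> N v" for a b v
    using that out_sc[of v a b] by (auto simp: N_def)
  have "\<forall>v\<in>V. \<exists>S. kernel_on E (V - {v}) S" using proper_kernel by blast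
  then obtain S where S: "\<And>v. v \<in> V \<Longrightarrow> kernel_on E (V - {v}) (S v)" by metis
  have meet: "card (N w \<inter> S v) = of_bool (w \<noteq> v)" if wv: "w \<in> V" "v \<in> V" for w v
  proof -
    have Sv: "S v \<subseteq> V - {v}" "\<And>a b. a \<in> S v \<Longrightarrow> b \<in> S v \<Longrightarrow> \<not> E a b"
      "\<And>a. a \<in> V - {v} \<Longrightarrow> a \<notin> S v \<Longrightarrow> \<exists>b\<in>S v. E a b"
      using S[OF wv(2)] by (auto simp: kernel_on_def)
    show ?thesis
    proof (cases "w = v")
      case True
      \<comment> \<open>If \<open>v\<close> had an arc into \<open>S v\<close>, then
        \<open>S v\<close> would be a kernel of the whole digraph.\<close>
      have "\<not> E v t" if "t \<in> S v" for t
      proof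
        assume "E v t"
        then have "kernel_on E V (S v)"
          using Sv that by (intro kernel_onI) (blast intro: Sv(3))+
        then show False using no_kernel by blast
      qed
      then have "N w \<inter> S v = {}" using True Sv by (auto simp: N_def)
      then show ?thesis using True by simp
    next
      case False
      have "\<exists>t. t \<in> N w \<inter> S v"
      proof (cases "w \<in> S v")
        case False
        then obtain b where "b \<in> S v" "E w b" using Sv(3)[of w] wv \<open>w \<noteq> v\<close> by blast
        then show ?thesis using Sv(1) by (auto simp: N_def)
      qed (auto simp: N_def)
      then obtain t where t: "t \<in> N w \<inter> S v" by blast
      then have "N w \<inter> S v = {t}" using N_clique Sv(2) by blast
      then show ?thesis using False by simp
    qed
  qed
  have "card {u0, v0} \<le> card V" using nadj finite_V by (intro card_mono) auto
  then have two: "card V \<ge> 2" using nadj by simp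
  have "S v \<subseteq> V" if "v \<in> V" for v using S[OF that] by (auto simp: kernel_on_def)
  then have "\<exists>c. \<forall>v\<in>V. card (N v) = c \<and> card {w \<in> V. v \<in> N w} = c"
    by (intro regular_if_complementary[of V N S] finite_V two meet) (auto simp: N_def)
  then obtain c where c: "\<And>v. v \<in> V \<Longrightarrow> card (N v) = c" "\<And>v. v \<in> V \<Longrightarrow> card {w \<in> V. v \<in> N w} = c"
    by blast
  have "\<exists>q\<in>V. {w \<in> V. q \<in> N w} = N v" if v: "v \<in> V" for v
  proof -
    have NV: "N v \<subseteq> V" using v by (auto simp: N_def)
    have "N v \<noteq> V" using N_clique[of u0 v v0] nadj by blast
    then obtain K where K: "kernel_on E (N v) K" using proper_kernel NV by blast
    have "K \<noteq> {}" using K by (auto simp: kernel_on_def N_def)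
    then obtain q where q: "q \<in> K" by blast
    have "K = {q}"
      using K q N_clique[of _ v q] unfolding kernel_on_def by blast
    then have "q \<in> V" "N v \<subseteq> {w \<in> V. q \<in> N w}"
      using K NV by (auto simp: kernel_on_def N_def)
    \<comment> \<open>Equal out-degrees and in-degrees turn the inclusion into an equality.\<close>
    moreover have "card (N v) = card {w \<in> V. q \<in> N w}" using c v \<open>q \<in> V\<close> by simp
    ultimately have "N v = {w \<in> V. q \<in> N w}" using finite_V by (intro card_subset_eq) auto
    then show ?thesis using \<open>q \<in> V\<close> by blast
  qed
  then obtain q where q: "\<And>v. v \<in> V \<Longrightarrow> q v \<in> V" "\<And>v. v \<in> V \<Longrightarrow> {w \<in> V. q v \<in> N w} = N v"
    by metis
  have "inj_on q V"
  proof (rule inj_onI, rule ccontr)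
    fix a b assume ab: "a \<in> V" "b \<in> V" "q a = q b" "a \<noteq> b"
    then have "N a = N b" using q(2) by metis
    \<comment> \<open>If \<open>N a = N b\<close>, the set \<open>S a\<close> would both miss and
      meet it.\<close>
    then show False using meet[of a a] meet[of b a] ab by simp
  qed
  then have "q ` V = V" using q(1) finite_V by (intro endo_inj_surj) auto
  moreover have "x \<in> V" using ux E_in_V by blast
  ultimately obtain z where z: "z \<in> V" "x = q z" by blast
  have "u \<in> N z" "v \<in> N z" using q(2)[OF z(1)] ux vx E_in_V by (auto simp: N_def z(2))
  then show ?thesis by (rule N_clique)
qed

end

section \<open>Digraphs\<close>

lemma circulant_on_iso:
  assumes "digraph D" and circ: "circulant_on (verts D) (\<lambda>u v. u \<rightarrow>\<^bsub>D\<^esub> v) n J"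
  shows "digraph_iso D (circulant_digraph n J)"
proof -
  interpret digraph D by fact
  obtain g where g: "bij_betw g {0..<int n} (verts D)"
    and arc: "\<And>i j. i \<in> {0..<int n} \<Longrightarrow> j \<in> {0..<int n} \<Longrightarrow>
      g i \<rightarrow>\<^bsub>D\<^esub> g j \<longleftrightarrow> (\<exists>k\<in>J. [j - i = k] (mod int n))"
    using circ by (auto simp: circulant_on_def)
  define f where "f = the_inv_into {0..<int n} g"
  have f: "bij_betw f (verts D) {0..<int n}" unfolding f_def by (rule bij_betw_the_inv_into[OF g])
  have gf: "g (f v) = v" if "v \<in> verts D" for v
    using that g unfolding f_def by (metis bij_betw_def f_the_inv_into_f)
  have fg: "f (g i) = i" if "i \<in> {0..<int n}" for i
    using that g unfolding f_def by (metis bij_betw_def the_inv_into_f_f)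
  define h where "h a = (f (tail D a), f (head D a))" for a
  define iso where "iso = \<lparr>iso_verts = f, iso_arcs = h, iso_head = snd, iso_tail = fst\<rparr>"
  have "inj_on h (arcs D)"
  proof (rule inj_onI)
    fix a b assume "a \<in> arcs D" "b \<in> arcs D" "h a = h b"
    then have "tail D a = tail D b" "head D a = head D b"
      unfolding h_def using gf tail_in_verts head_in_verts by (metis prod.inject)+
    then show "a = b" using no_multi_arcs \<open>a \<in> arcs D\<close> \<open>b \<in> arcs D\<close> by (simp add: arc_to_ends_def)
  qed
  moreover have "inj_on f (verts D)" using f by (simp add: bij_betw_def)
  ultimately have "digraph_isomorphism iso"
    unfolding digraph_isomorphism_def iso_def using wf_digraph by (simp add: h_def)
  moreover have "circulant_digraph n J = app_iso iso D"
  proof -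
    have "h ` arcs D = {(i, j). i \<in> {0..<int n} \<and> j \<in> {0..<int n} \<and> (\<exists>k \<in> J. [j - i = k] (mod int n))}"
    proof (intro equalityI subsetI)
      fix x assume "x \<in> h ` arcs D"
      then obtain a where a: "a \<in> arcs D" "x = h a" by blast
      have ends: "tail D a \<in> verts D" "head D a \<in> verts D" using a by auto
      then have "f (tail D a) \<in> {0..<int n}" "f (head D a) \<in> {0..<int n}"
        using f by (auto simp: bij_betw_def)
      moreover have "g (f (tail D a)) \<rightarrow>\<^bsub>D\<^esub> g (f (head D a))"
        using gf ends a by (auto simp: arcs_ends_conv)
      ultimately show "x \<in> {(i, j). i \<in> {0..<int n} \<and> j \<in> {0..<int n} \<and> (\<exists>k \<in> J. [j - i = k] (mod int n))}"
        using arc a by (simp add: h_def)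
    next
      fix x assume "x \<in> {(i, j). i \<in> {0..<int n} \<and> j \<in> {0..<int n} \<and> (\<exists>k \<in> J. [j - i = k] (mod int n))}"
      then obtain i j where x: "x = (i, j)" "i \<in> {0..<int n}" "j \<in> {0..<int n}"
        "\<exists>k \<in> J. [j - i = k] (mod int n)" by blast
      then have "g i \<rightarrow>\<^bsub>D\<^esub> g j" using arc by blast
      then obtain a where "a \<in> arcs D" "tail D a = g i" "head D a = g j" by auto
      then show "x \<in> h ` arcs D" using x fg by (auto simp: h_def intro!: image_eqI[of _ _ a])
    qed
    moreover have "f ` verts D = {0..<int n}" using f by (simp add: bij_betw_def)
    ultimately show ?thesis
      by (simp add: circulant_digraph_def with_proj_def app_iso_def iso_def)
  qed
  ultimately show ?thesis unfolding digraph_iso_def by blast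
qed

lemma circulant_1_directed_cycle:
  assumes "digraph D" and circ: "circulant_on (verts D) (\<lambda>u v. u \<rightarrow>\<^bsub>D\<^esub> v) n {1}" and "odd n"
  shows "directed_odd_cycle D"
proof -
  interpret digraph D by fact
  obtain g where g: "bij_betw g {0..<int n} (verts D)"
    and arc: "\<And>i j. i \<in> {0..<int n} \<Longrightarrow> j \<in> {0..<int n} \<Longrightarrow>
      g i \<rightarrow>\<^bsub>D\<^esub> g j \<longleftrightarrow> [j - i = 1] (mod int n)"
    using circ by (auto simp: circulant_on_def)
  have n: "n > 0" using \<open>odd n\<close> by (cases n) auto
  \<comment> \<open>Periodic indexing closes the walk: \<open>v n = v 0\<close>.\<close>
  define v where "v i = g (int i mod int n)" for i :: nat
  have m_in: "int i mod int n \<in> {0..<int n}" for i using n by simp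
  have v_arc: "v i \<rightarrow>\<^bsub>D\<^esub> v (Suc i)" for i
    unfolding v_def arc[OF m_in m_in] by (simp add: cong_def mod_diff_eq)
  then have "\<forall>i. \<exists>a. a \<in> arcs D \<and> tail D a = v i \<and> head D a = v (Suc i)" by blast
  then obtain e where e: "\<And>i. e i \<in> arcs D" "\<And>i. tail D (e i) = v i" "\<And>i. head D (e i) = v (Suc i)"
    by metis
  define p where "p = map e [0..<n]"
  have cas: "cas (v i) (map e [i..<j]) (v j)" if "i \<le> j" for i j
    using that by (induction rule: inc_induct) (auto simp: upt_conv_Cons e)
  have av: "awalk_verts (v i) (map e [i..<j]) = map v [i..<Suc j]" if "i \<le> j" for i j
    using that by (induction rule: inc_induct) (auto simp: upt_conv_Cons e simp del: upt_Suc)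
  have vV: "v i \<in> verts D" for i using v_arc adj_in_verts by blast
  have vn: "v n = v 0" by (simp add: v_def)
  have v_inj: "inj_on v {1..<Suc n}"
  proof (rule inj_onI)
    fix i j assume ij: "i \<in> {1..<Suc n}" "j \<in> {1..<Suc n}" "v i = v j"
    then have "int i mod int n = int j mod int n"
      unfolding v_def using g m_in by (metis bij_betw_def inj_onD)
    then have "i mod n = j mod n" by (metis of_nat_eq_iff of_nat_mod)
    then show "i = j" using ij by (cases "i = n"; cases "j = n") auto
  qed
  have "awalk (v 0) p (v 0)"
    unfolding awalk_def p_def using cas[of 0 n] vV e by (auto simp: vn)
  moreover have "distinct (tl (awalk_verts (v 0) p))"
    using v_inj av[of 0 n] by (simp add: p_def upt_conv_Cons distinct_map del: upt_Suc)
  ultimately have "cycle p" unfolding cycle_def using n by (intro exI[of _ "v 0"]) (auto simp: p_def)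
  moreover have "verts D = tail D ` set p"
  proof -
    have "tail D ` set p = v ` {0..<n}" by (simp add: p_def image_image e)
    also have "\<dots> = g ` {0..<int n}"
    proof (intro equalityI subsetI)
      fix x assume "x \<in> g ` {0..<int n}"
      then obtain i where "i \<in> {0..<int n}" "x = g i" by blast
      then show "x \<in> v ` {0..<n}" by (intro image_eqI[of _ _ "nat i"]) (auto simp: v_def)
    qed (auto simp: v_def)
    finally show ?thesis using g by (simp add: bij_betw_def)
  qed
  \<comment> \<open>Each arc has the ends of some \<open>e i\<close>, and there are no parallel
    arcs.\<close>
  moreover have "arcs D \<subseteq> set p"
  proof
    fix a assume a: "a \<in> arcs D"
    have "tail D a \<in> g ` {0..<int n}" "head D a \<in> g ` {0..<int n}"
      using a g by (auto simp: bij_betw_def)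
    then obtain i j where ij: "i \<in> {0..<int n}" "j \<in> {0..<int n}" "tail D a = g i" "head D a = g j"
      by blast
    have "g i \<rightarrow>\<^bsub>D\<^esub> g j" using a ij by (auto simp: arcs_ends_conv intro: image_eqI[of _ _ a])
    then have "[j = i + 1] (mod int n)"
      using arc[OF ij(1,2)] by (simp add: cong_iff_dvd_diff algebra_simps)
    then have "j = (i + 1) mod int n" using ij(2) by (simp add: cong_def)
    then have "tail D a = v (nat i)" "head D a = v (Suc (nat i))"
      using ij by (auto simp: v_def ac_simps)
    then have "arc_to_ends D a = arc_to_ends D (e (nat i))" by (simp add: arc_to_ends_def e)
    then have "a = e (nat i)" using no_multi_arcs a e(1) by blast
    then show "a \<in> set p" using ij(1) by (auto simp: p_def)
  qed
  moreover have "set p \<subseteq> arcs D" using e by (auto simp: p_def)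
  moreover have "odd (length p)" using \<open>odd n\<close> by (simp add: p_def)
  ultimately show ?thesis unfolding directed_odd_cycle_def by blast
qed

lemma dominates_induce_iff:
  assumes "u \<in> X" "v \<in> X"
  shows "u \<rightarrow>\<^bsub>D \<restriction> X\<^esub> v \<longleftrightarrow> u \<rightarrow>\<^bsub>D\<^esub> v"
  using assms by (auto simp: arcs_ends_conv image_iff)

lemma CKI_relation_digraph:
  assumes "CKI_digraph D"
  shows "CKI_relation (verts D) (\<lambda>u v. u \<rightarrow>\<^bsub>D\<^esub> v)"
proof -
  interpret digraph D using assms by (simp add: CKI_digraph_def)
  show ?thesis
  proof
    show "\<not> kernel_on (\<lambda>u v. u \<rightarrow>\<^bsub>D\<^esub> v) (verts D) S" for S
      using assms by (auto simp: CKI_digraph_def has_kernel_def is_kernel_def kernel_on_def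
          independent_in_def absorbent_in_def)
    fix X assume X: "X \<subset> verts D"
    then have "induced_subgraph (D \<restriction> X) D" by (intro induced_induce) auto
    then obtain S where S: "is_kernel (D \<restriction> X) S"
      using assms X unfolding CKI_digraph_def has_kernel_def by (metis induce_subgraph_verts psubset_eq)
    then have "kernel_on (\<lambda>u v. u \<rightarrow>\<^bsub>D\<^esub> v) X S"
      using dominates_induce_iff[of _ X _ D]
      unfolding is_kernel_def independent_in_def absorbent_in_def kernel_on_def induce_subgraph_verts
      by (metis DiffD1 subsetD)
    then show "\<exists>S. kernel_on (\<lambda>u v. u \<rightarrow>\<^bsub>D\<^esub> v) X S" by blast
  qed (auto dest: adj_in_verts adj_not_same)
qed

lemma semicomplete_induceD:
  assumes "semicomplete (D \<restriction> X)" "u \<in> X" "v \<in> X" "u \<noteq> v"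
  shows "u \<rightarrow>\<^bsub>D\<^esub> v \<or> v \<rightarrow>\<^bsub>D\<^esub> u"
  using assms dominates_induce_iff[of _ X _ D] by (auto simp: semicomplete_def)

theorem theorem7:
  fixes D :: "('a, 'b) pre_digraph"
  assumes "(locally_in_semicomplete D \<and> CKI_digraph D) \<or>
           (locally_out_semicomplete D \<and> CKI_digraph D)"
  shows "directed_odd_cycle D \<or>
         digraph_iso D (circulant_digraph 7 {1, 2}) \<or>
         (\<exists>n\<ge>4. digraph_iso D
            (circulant_digraph n ({1} \<union> (\<Union>k \<in> {2..\<lfloor>real n / 2\<rfloor>}. {k, - k}))))"
proof -
  have D: "CKI_digraph D" using assms by blast
  then interpret digraph D by (simp add: CKI_digraph_def)
  let ?E = "\<lambda>u v. u \<rightarrow>\<^bsub>D\<^esub> v"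
  interpret C: CKI_relation "verts D" ?E by (rule CKI_relation_digraph[OF D])
  have "(\<exists>n. odd n \<and> circulant_on (verts D) ?E n {1}) \<or> circulant_on (verts D) ?E 7 {1, 2} \<or>
    (\<exists>n\<ge>4. circulant_on (verts D) ?E n ({1} \<union> (\<Union>k\<in>{2..\<lfloor>real n / 2\<rfloor>}. {k, - k})))"
  proof (cases "\<forall>u\<in>verts D. \<forall>v\<in>verts D. u \<noteq> v \<longrightarrow> ?E u v \<or> ?E v u")
    case True
    then show ?thesis using C.semicomplete_CKI_circulant by blast
  next
    case False
    then obtain u0 v0 where nadj: "u0 \<in> verts D" "v0 \<in> verts D" "u0 \<noteq> v0" "\<not> ?E u0 v0" "\<not> ?E v0 u0"
      by blast
    \<comment> \<open>Both alternatives of the hypothesis lead to semicomplete in-neighbourhoods,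
      the out-version by way of the nonadjacent pair.\<close>
    have "in_semicomplete_CKI (verts D) ?E"
    proof unfold_locales
      fix u x v assume ux: "?E u x" and vx: "?E v x"
      show "u = v \<or> ?E u v \<or> ?E v u"
      proof (cases "locally_in_semicomplete D")
        case True
        then have sc: "semicomplete (D \<restriction> in_neighbourhood D x)"
          using adj_in_verts(2)[OF ux] by (simp add: locally_in_semicomplete_def)
        have "u \<in> in_neighbourhood D x" "v \<in> in_neighbourhood D x"
          using ux vx adj_in_verts(1) by (simp_all add: in_neighbourhood_def)
        then show ?thesis using semicomplete_induceD[OF sc] by metis
      next
        case False
        then have out: "locally_out_semicomplete D" using assms by blast
        have "out_semicomplete_CKI (verts D) ?E"
        proof unfold_locales
          fix z a b assume za: "?E z a" and zb: "?E z b"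
          have sc: "semicomplete (D \<restriction> out_neighbourhood D z)"
            using out adj_in_verts(1)[OF za] by (simp add: locally_out_semicomplete_def)
          have "a \<in> out_neighbourhood D z" "b \<in> out_neighbourhood D z"
            using za zb adj_in_verts(2) by (simp_all add: out_neighbourhood_def)
          then show "a = b \<or> ?E a b \<or> ?E b a" using semicomplete_induceD[OF sc] by metis
        qed
        from out_semicomplete_CKI.in_semicomplete[OF this nadj ux vx] show ?thesis .
      qed
    qed
    from in_semicomplete_CKI.non_semicomplete_classification[OF this nadj]
    show ?thesis by blast
  qed
  then show ?thesis
    using circulant_1_directed_cycle[OF digraph_axioms] circulant_on_iso[OF digraph_axioms] by blast
qed

end
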